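(* Let $r>0$. The mean distance $M_1$ between two uniformly and independently distributed random points in the regular dodecagon $\mathcal{P}_{12,r}$ satisfies \begin{align*} \frac{M_1}{r}={}&\frac1{1080\sqrt2}\Bigg[504-660\sqrt2+396\sqrt3-4\sqrt6+2\left(3+\sqrt3\right)\sqrt{2+\sqrt3}\\ &+6\left(1+47\sqrt3\right)\sqrt{2-\sqrt3}-\frac{27}{2}\left(15+11\sqrt3\right)\ln3-4\left(27-\sqrt3\right)\ln\left(1+\sqrt2\right)\\ &-4\sqrt3\ln\left(2+\sqrt3\right)+2\left(666+397\sqrt3\right)\ln\left(2-\sqrt3\right)\\ &-\left(33-19\sqrt3\right)\ln\left(2+\sqrt{2+\sqrt3}\right)+3\left(899+523\sqrt3\right)\ln\left(2+\sqrt{2-\sqrt3}\right)\Bigg]. \end{align*}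
   Context: $\mathcal{P}_{n,r}$ is the (filled) regular polygon with $n$ sides whose circumscribed circle has radius $r$. The mean distance $M_1$ is the expected Euclidean distance between two points chosen independently and uniformly (w.r.t. area) from the polygon. *)

theory Defs
  imports "HOL-Analysis.Analysis"
begin

(* The plane is identified with the complex numbers; the position of the polygon is normalised:
   circumcentre 0 and one vertex at r. *)
definition regular_polygon :: "nat \<Rightarrow> real \<Rightarrow> complex set" where
  "regular_polygon n r =
     convex hull ((\<lambda>k. complex_of_real r * cis (2 * pi * real k / real n)) ` {..<n})"

definition mean_distance :: "'a::euclidean_space set \<Rightarrow> real" where
  "mean_distance S =
     (LINT p|(uniform_measure lborel S \<Otimes>\<^sub>M uniform_measure lborel S). dist (fst p) (snd p))"

end

(* Write |x - y| as a divergence in x of (x - y)|x - y|/3, and (y - x)|y - x| as the gradient in y of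
   |y - x|^3/3. Applying the divergence theorem twice turns the integral of |x - y| over K x K into
   -1/9 times the sum, over all pairs of sides with side vectors d_j, d_k, of <d_j, d_k> times the double
   integral of |p - q|^3 over p, q on the two sides; by rotation, 12 relative positions remain.
   For two sides that are not parallel, use as coordinates the distances u, v from the intersection point
   of their lines: the integrand becomes (u^2 + v^2 - 2uvc)^(3/2), which is homogeneous of degree 3, so
   Euler's identity reduces its double primitive to a one-dimensional one.
   All numbers that occur lie in Q(sqrt 2, sqrt 3). *)
theory Submission
  imports Defs
begin

subsection \<open>The dodecagon as a region between two graphs\<close>

text \<open>The dodecagon is symmetric in both axes and in the diagonal, so one function,
  \<open>half_width\<close>, bounds its horizontal and its vertical sections. Green's formula then
  amounts to Fubini, the fundamental theorem on each section and a substitution on each side. One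
  obstacle is that the distance is not differentiable where the two points coincide. Primitives are
  therefore only required to be continuous everywhere and to have the right derivative away from one
  point. The other obstacle is a pair of adjacent sides: their lines meet in a common end point,
  where the logarithm in the primitive is singular. Homogeneity supplies the factor u^5, which
  removes the singularity. The corners of each double integral are pairs of vertices, so only the
  side and the diagonals of the dodecagon occur there as third sides. This is why the square roots
  of 2 and 3 suffice; the nested radicals in the result are halves of \<open>sqrt 6 + sqrt 2\<close>
  and \<open>sqrt 6 - sqrt 2\<close>.\<close>

lemma continuous_Complex2: "continuous_on UNIV (\<lambda>p. Complex (fst p) (snd p))"
  unfolding Complex_eq by (intro continuous_intros)

text \<open>Lebesgue measure is determined by its values on boxes, and \<open>Complex\<close>
  carries boxes to boxes of the same volume. This makes Fubini's theorem available in the complex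
  plane.\<close>

lemma lborel_complex:
  "(lborel :: complex measure) = distr (lborel :: (real \<times> real) measure) borel (\<lambda>p. Complex (fst p) (snd p))"
proof (rule lborel_eqI)
  have [measurable]: "(\<lambda>p. Complex (fst p) (snd p)) \<in> borel_measurable borel"
    by (rule borel_measurable_continuous_onI[OF continuous_Complex2])
  fix l u :: complex
  assume le: "\<And>b. b \<in> Basis \<Longrightarrow> l \<bullet> b \<le> u \<bullet> b"
  have le2: "Re l \<le> Re u" "Im l \<le> Im u"
    using le[of 1] le[of "\<i>"] by (auto simp: Basis_complex_def)
  have eq: "(\<lambda>p. Complex (fst p) (snd p)) -` box l u = box (Re l, Im l) (Re u, Im u)"
    by (auto simp: box_def Basis_complex_def Basis_prod_def)
  show "emeasure (distr lborel borel (\<lambda>p. Complex (fst p) (snd p))) (box l u) = (\<Prod>b\<in>Basis. (u - l) \<bullet> b)"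
  proof -
    have "emeasure (distr lborel borel (\<lambda>p. Complex (fst p) (snd p))) (box l u)
       = emeasure lborel (box (Re l, Im l) (Re u, Im u))"
      by (subst emeasure_distr) (auto simp: eq)
    also have "\<dots> = (\<Prod>b\<in>Basis. ((Re u, Im u) - (Re l, Im l)) \<bullet> b)"
      by (rule emeasure_lborel_box) (use le2 in \<open>auto simp: Basis_prod_def\<close>)
    also have "\<dots> = (\<Prod>b\<in>Basis. (u - l) \<bullet> b)"
      by (simp add: Basis_complex_def Basis_prod_def mult.commute)
    finally show ?thesis .
  qed
qed simp

lemma integral_complex:
  fixes f :: "complex \<Rightarrow> real"
  assumes [measurable]: "f \<in> borel_measurable borel"
  shows "(\<integral>z. f z \<partial>lborel) = (\<integral>p. f (Complex (fst p) (snd p)) \<partial>(lborel \<Otimes>\<^sub>M lborel))"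
proof -
  have [measurable]: "(\<lambda>p. Complex (fst p) (snd p)) \<in> borel_measurable borel"
    by (rule borel_measurable_continuous_onI[OF continuous_Complex2])
  show ?thesis
    unfolding lborel_prod by (subst lborel_complex, subst integral_distr) auto
qed

lemma integrable_complex:
  fixes f :: "complex \<Rightarrow> real"
  assumes [measurable]: "f \<in> borel_measurable borel"
  assumes "integrable lborel f"
  shows "integrable (lborel \<Otimes>\<^sub>M lborel) (\<lambda>p. f (Complex (fst p) (snd p)))"
proof -
  have [measurable]: "(\<lambda>p. Complex (fst p) (snd p)) \<in> borel_measurable borel"
    by (rule borel_measurable_continuous_onI[OF continuous_Complex2])
  have "integrable (distr (lborel :: (real \<times> real) measure) borel (\<lambda>p. Complex (fst p) (snd p))) f"
    using assms(2) by (subst (asm) lborel_complex)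
  then show ?thesis
    unfolding lborel_prod by (subst (asm) integrable_distr_eq) auto
qed

text \<open>The three terms are the lines through the sides between the vertices at 0, 30, 60 and 90
  degrees, solved for the abscissa; the absolute value adds their mirror images. Beyond
  \<open>\<bar>y\<bar> = r\<close> the minimum is negative, so the formula also describes the empty
  sections.\<close>

definition half_width :: "real \<Rightarrow> real \<Rightarrow> real" where
  "half_width r y = min (r - (2 - sqrt 3) * \<bar>y\<bar>) (min ((1 + sqrt 3) / 2 * r - \<bar>y\<bar>) ((2 + sqrt 3) * (r - \<bar>y\<bar>)))"

definition dodecagon :: "real \<Rightarrow> complex set" where
  "dodecagon r = {z. \<bar>Re z\<bar> \<le> half_width r (Im z)}"

lemma sqrt3_bounds: "1.7 < sqrt 3" "sqrt 3 < 1.74"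
  by (rule real_less_rsqrt real_less_lsqrt; simp add: power2_eq_square)+

lemma two_minus_sqrt3_le: "(2 - sqrt 3) * u \<le> w \<longleftrightarrow> u \<le> (2 + sqrt 3) * w"
proof -
  have "(2 + sqrt 3) * ((2 - sqrt 3) * u) = u" by (simp add: algebra_simps)
  moreover have "2 + sqrt 3 > 0" using sqrt3_bounds by linarith
  ultimately show ?thesis by (metis mult_le_cancel_left_pos)
qed

text \<open>Reflection in the diagonal exchanges the first and the third term of
  \<open>half_width\<close>, because \<open>2 - sqrt 3\<close> and \<open>2 + sqrt 3\<close> are
  inverse to each other, and preserves the second. Vertical sections are thus governed by the same
  function as horizontal ones.\<close>

lemma dodecagon_swap: "Complex x y \<in> dodecagon r \<longleftrightarrow> \<bar>y\<bar> \<le> half_width r x"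
  unfolding dodecagon_def half_width_def
  using two_minus_sqrt3_le[of "\<bar>x\<bar>" "r - \<bar>y\<bar>"] two_minus_sqrt3_le[of "\<bar>y\<bar>" "r - \<bar>x\<bar>"]
  by (auto simp: min.bounded_iff)

lemma continuous_half_width: "continuous_on S (half_width r)"
  unfolding half_width_def[abs_def] by (intro continuous_intros)

lemma closed_dodecagon: "closed (dodecagon r)"
  unfolding dodecagon_def half_width_def by (intro closed_Collect_le continuous_intros)

lemma half_width_nonneg: "0 \<le> half_width r y \<Longrightarrow> \<bar>y\<bar> \<le> r"
  unfolding half_width_def using sqrt3_bounds by (auto simp: zero_le_mult_iff)

lemma half_width_nonneg_iff: "0 \<le> half_width r y \<longleftrightarrow> \<bar>y\<bar> \<le> r"
proof
  assume a: "\<bar>y\<bar> \<le> r"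
  have r: "0 \<le> r" using a by linarith
  have "(2 - sqrt 3) * \<bar>y\<bar> \<le> 1 * \<bar>y\<bar>" using sqrt3_bounds by (intro mult_right_mono) auto
  moreover have "1 * r \<le> (1 + sqrt 3) / 2 * r" using sqrt3_bounds r by (intro mult_right_mono) auto
  ultimately show "0 \<le> half_width r y" using a r unfolding half_width_def
    by (simp add: zero_le_mult_iff)
qed (rule half_width_nonneg)

lemma half_width_le: "half_width r y \<le> r"
proof -
  have "(2 - sqrt 3) * \<bar>y\<bar> \<ge> 0" using sqrt3_bounds by (intro mult_nonneg_nonneg) auto
  then show ?thesis unfolding half_width_def by linarith
qed

lemma compact_dodecagon: "compact (dodecagon r)"
proof -
  have "norm z \<le> r + r" if "z \<in> dodecagon r" for z
  proof -
    have "\<bar>Re z\<bar> \<le> half_width r (Im z)" using that by (simp add: dodecagon_def)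
    moreover from this have "\<bar>Im z\<bar> \<le> r" by (intro half_width_nonneg) linarith
    ultimately show ?thesis using half_width_le[of r "Im z"] cmod_le[of z] by linarith
  qed
  then have "bounded (dodecagon r)" by (auto simp: bounded_iff)
  then show ?thesis using closed_dodecagon by (simp add: compact_eq_bounded_closed)
qed

text \<open>The fundamental theorem tolerates exceptional points as long as the primitive is
  continuous. One is allowed here, since the integrands will involve the distance from a fixed
  point, which a section may meet.\<close>

lemma inner_section:
  fixes F G :: "real \<Rightarrow> real \<Rightarrow> real"
  assumes F: "continuous_on UNIV (\<lambda>x. F x y)" and G: "continuous_on UNIV (\<lambda>x. G x y)"
    and deriv: "\<And>x. x \<noteq> w \<Longrightarrow> ((\<lambda>x. G x y) has_real_derivative F x y) (at x)"
  shows "(\<integral>x. indicator {x. \<bar>x\<bar> \<le> half_width r y} x * F x y \<partial>lborel)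
    = indicator {-r..r} y * (G (half_width r y) y - G (- half_width r y) y)"
proof (cases "\<bar>y\<bar> \<le> r")
  case True
  let ?h = "half_width r y"
  have h: "0 \<le> ?h" using True half_width_nonneg_iff by simp
  have e: "{x. \<bar>x\<bar> \<le> ?h} = {-?h..?h}" by auto
  have "((\<lambda>x. F x y) has_integral (G ?h y - G (-?h) y)) {-?h..?h}"
    by (rule fundamental_theorem_of_calculus_interior_strong[where S = "{w}"])
      (use h deriv G in \<open>auto simp: has_real_derivative_iff_has_vector_derivative[symmetric] intro: continuous_on_subset\<close>)
  moreover have "set_integrable lborel {-?h..?h} (\<lambda>x. F x y)"
    unfolding set_integrable_def
    by (rule borel_integrable_compact) (use F in \<open>auto intro: continuous_on_subset\<close>)
  ultimately have "(LINT x:{-?h..?h}|lborel. F x y) = G ?h y - G (-?h) y"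
    by (metis set_borel_integral_eq_integral(2) integral_unique)
  then show ?thesis unfolding e set_lebesgue_integral_def using True by (simp add: abs_le_iff)
next
  case False
  then have "half_width r y < 0" using half_width_nonneg_iff[of r y] by linarith
  then have "{x. \<bar>x\<bar> \<le> half_width r y} = {}" by auto
  moreover have "y \<notin> {-r..r}" using False by auto
  ultimately show ?thesis by (simp only: indicator_simps) simp
qed

lemma integral_indicator_interval:
  fixes H :: "real \<Rightarrow> real"
  assumes "continuous_on {a..b} H"
  shows "(\<integral>y. indicator {a..b} y * H y \<partial>lborel) = integral {a..b} H"
proof -
  have "set_integrable lborel {a..b} H"
    unfolding set_integrable_def by (rule borel_integrable_compact) (use assms in auto)
  from set_borel_integral_eq_integral(2)[OF this] show ?thesis
    by (simp add: set_lebesgue_integral_def)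
qed

lemma integrable_dodecagon:
  fixes f :: "complex \<Rightarrow> real"
  assumes "continuous_on UNIV f"
  shows "integrable lborel (\<lambda>z. indicator (dodecagon r) z * f z)"
    "(\<lambda>z. indicator (dodecagon r) z * f z) \<in> borel_measurable borel"
proof -
  show "integrable lborel (\<lambda>z. indicator (dodecagon r) z * f z)"
    using borel_integrable_compact[OF compact_dodecagon, of r f] assms
    by (auto intro: continuous_on_subset)
  then show "(\<lambda>z. indicator (dodecagon r) z * f z) \<in> borel_measurable borel"
    using borel_measurable_integrable by force
qed

lemma horizontal_section:
  fixes f g :: "complex \<Rightarrow> real"
  assumes f: "continuous_on UNIV f" and g: "continuous_on UNIV g"
    and deriv: "\<And>x y. Complex x y \<noteq> w \<Longrightarrow> ((\<lambda>x. g (Complex x y)) has_real_derivative f (Complex x y)) (at x)"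
  shows "(\<integral>z. indicator (dodecagon r) z * f z \<partial>lborel) =
    integral {-r..r} (\<lambda>y. g (Complex (half_width r y) y) - g (Complex (- half_width r y) y))"
proof -
  let ?F = "\<lambda>x y. indicator (dodecagon r) (Complex x y) * f (Complex x y)"
  have cC: "continuous_on UNIV (\<lambda>x. Complex (u x) (v x))" if "continuous_on UNIV u" "continuous_on UNIV v" for u v :: "real \<Rightarrow> real"
    unfolding Complex_eq by (intro continuous_intros that)
  have "(\<integral>z. indicator (dodecagon r) z * f z \<partial>lborel) = (\<integral>p. ?F (fst p) (snd p) \<partial>(lborel \<Otimes>\<^sub>M lborel))"
    by (rule integral_complex) (rule integrable_dodecagon[OF f])
  also have "\<dots> = (\<integral>y. (\<integral>x. ?F x y \<partial>lborel) \<partial>lborel)"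
    using lborel_pair.integral_snd[of ?F] integrable_complex[OF integrable_dodecagon(2,1)[OF f, of r]]
    by (simp add: case_prod_beta')
  also have "\<dots> = (\<integral>y. indicator {-r..r} y * (g (Complex (half_width r y) y) - g (Complex (- half_width r y) y)) \<partial>lborel)"
  proof (rule Bochner_Integration.integral_cong[OF refl])
    fix y :: real
    have "(\<integral>x. ?F x y \<partial>lborel) = (\<integral>x. indicator {x. \<bar>x\<bar> \<le> half_width r y} x * f (Complex x y) \<partial>lborel)"
      by (rule Bochner_Integration.integral_cong) (auto simp: dodecagon_def indicator_def)
    also have "\<dots> = indicator {-r..r} y * (g (Complex (half_width r y) y) - g (Complex (- half_width r y) y))"
    \<comment> \<open>Only one horizontal line passes through \<open>w\<close>; its abscissa serves
      as exceptional point on all of them.\<close>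
    proof (rule inner_section[where w = "Re w" and F = "\<lambda>x y. f (Complex x y)" and G = "\<lambda>x y. g (Complex x y)"])
      show "continuous_on UNIV (\<lambda>x. f (Complex x y))" "continuous_on UNIV (\<lambda>x. g (Complex x y))"
        by (rule continuous_on_compose2[OF f cC] continuous_on_compose2[OF g cC]; auto intro: continuous_intros)+
      show "((\<lambda>x. g (Complex x y)) has_real_derivative f (Complex x y)) (at x)" if "x \<noteq> Re w" for x
        by (rule deriv) (use that in auto)
    qed
    finally show "(\<integral>x. ?F x y \<partial>lborel) = indicator {-r..r} y * (g (Complex (half_width r y) y) - g (Complex (- half_width r y) y))" .
  qed
  also have "\<dots> = integral {-r..r} (\<lambda>y. g (Complex (half_width r y) y) - g (Complex (- half_width r y) y))"
  proof (rule integral_indicator_interval, intro continuous_on_diff)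
    show "continuous_on {-r..r} (\<lambda>y. g (Complex (half_width r y) y))"
      by (rule continuous_on_subset[OF continuous_on_compose2[OF g cC[OF continuous_half_width]]]) (auto intro: continuous_intros)
    show "continuous_on {-r..r} (\<lambda>y. g (Complex (- half_width r y) y))"
      by (rule continuous_on_subset[OF continuous_on_compose2[OF g cC[OF continuous_on_minus[OF continuous_half_width]]]]) (auto intro: continuous_intros)
  qed
  finally show ?thesis .
qed

lemma vertical_section:
  fixes f g :: "complex \<Rightarrow> real"
  assumes f: "continuous_on UNIV f" and g: "continuous_on UNIV g"
    and deriv: "\<And>x y. Complex x y \<noteq> w \<Longrightarrow> ((\<lambda>y. g (Complex x y)) has_real_derivative f (Complex x y)) (at y)"
  shows "(\<integral>z. indicator (dodecagon r) z * f z \<partial>lborel) =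
    integral {-r..r} (\<lambda>x. g (Complex x (half_width r x)) - g (Complex x (- half_width r x)))"
proof -
  let ?F = "\<lambda>x y. indicator (dodecagon r) (Complex x y) * f (Complex x y)"
  have cC: "continuous_on UNIV (\<lambda>x. Complex (u x) (v x))" if "continuous_on UNIV u" "continuous_on UNIV v" for u v :: "real \<Rightarrow> real"
    unfolding Complex_eq by (intro continuous_intros that)
  have "(\<integral>z. indicator (dodecagon r) z * f z \<partial>lborel) = (\<integral>p. ?F (fst p) (snd p) \<partial>(lborel \<Otimes>\<^sub>M lborel))"
    by (rule integral_complex) (rule integrable_dodecagon[OF f])
  also have "\<dots> = (\<integral>x. (\<integral>y. ?F x y \<partial>lborel) \<partial>lborel)"
    using lborel_pair.integral_fst[of ?F] integrable_complex[OF integrable_dodecagon(2,1)[OF f, of r]]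
    by (simp add: case_prod_beta')
  also have "\<dots> = (\<integral>x. indicator {-r..r} x * (g (Complex x (half_width r x)) - g (Complex x (- half_width r x))) \<partial>lborel)"
  proof (rule Bochner_Integration.integral_cong[OF refl])
    fix x :: real
    have "(\<integral>y. ?F x y \<partial>lborel) = (\<integral>y. indicator {y. \<bar>y\<bar> \<le> half_width r x} y * f (Complex x y) \<partial>lborel)"
      by (rule Bochner_Integration.integral_cong) (auto simp: dodecagon_swap indicator_def)
    also have "\<dots> = indicator {-r..r} x * (g (Complex x (half_width r x)) - g (Complex x (- half_width r x)))"
    proof (rule inner_section[where w = "Im w" and F = "\<lambda>y x. f (Complex x y)" and G = "\<lambda>y x. g (Complex x y)"])
      show "continuous_on UNIV (\<lambda>y. f (Complex x y))" "continuous_on UNIV (\<lambda>y. g (Complex x y))"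
        by (rule continuous_on_compose2[OF f cC] continuous_on_compose2[OF g cC]; auto intro: continuous_intros)+
      show "((\<lambda>y. g (Complex x y)) has_real_derivative f (Complex x y)) (at y)" if "y \<noteq> Im w" for y
        by (rule deriv) (use that in auto)
    qed
    finally show "(\<integral>y. ?F x y \<partial>lborel) = indicator {-r..r} x * (g (Complex x (half_width r x)) - g (Complex x (- half_width r x)))" .
  qed
  also have "\<dots> = integral {-r..r} (\<lambda>x. g (Complex x (half_width r x)) - g (Complex x (- half_width r x)))"
  proof (rule integral_indicator_interval, intro continuous_on_diff)
    show "continuous_on {-r..r} (\<lambda>x. g (Complex x (half_width r x)))"
      by (rule continuous_on_subset[OF continuous_on_compose2[OF g cC[OF continuous_on_id continuous_half_width]]]) auto
    show "continuous_on {-r..r} (\<lambda>x. g (Complex x (- half_width r x)))"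
      by (rule continuous_on_subset[OF continuous_on_compose2[OF g cC[OF continuous_on_id continuous_on_minus[OF continuous_half_width]]]]) auto
  qed
  finally show ?thesis .
qed

subsection \<open>The divergence theorem on the dodecagon\<close>

lemma integral_reverse01:
  fixes f :: "real \<Rightarrow> real"
  shows "integral {0..1} (\<lambda>t. f (1 - t)) = integral {0..1} f"
proof -
  \<comment> \<open>The equivalence for every value \<open>i\<close> also settles the non-integrable
    case, where both integrals are 0 by convention.\<close>
  have "((\<lambda>t. f (1 - t)) has_integral i) {0..1} \<longleftrightarrow> (f has_integral i) {0..1}" for i
  proof
    assume "(f has_integral i) {0..1}"
    from has_integral_affinity[of f i 0 1 "-1" 1] this
    show "((\<lambda>t. f (1 - t)) has_integral i) {0..1}" by simp
  next
    assume "((\<lambda>t. f (1 - t)) has_integral i) {0..1}"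
    from has_integral_affinity[of "\<lambda>t. f (1 - t)" i 0 1 "-1" 1] this
    show "(f has_integral i) {0..1}" by simp
  qed
  then show ?thesis unfolding integral_def integrable_on_def by presburger
qed

text \<open>Neighbouring lines cross at the ordinates \<open>r / 2\<close> and
  \<open>sqrt 3 / 2 * r\<close> of the vertices: the difference of two neighbouring terms is a
  positive constant times the signed distance from the crossing.\<close>

lemma half_width_cases:
  assumes "0 \<le> r"
  shows "\<bar>y\<bar> \<le> r / 2 \<Longrightarrow> half_width r y = r - (2 - sqrt 3) * \<bar>y\<bar>"
    and "r / 2 \<le> \<bar>y\<bar> \<Longrightarrow> \<bar>y\<bar> \<le> sqrt 3 / 2 * r \<Longrightarrow> half_width r y = (1 + sqrt 3) / 2 * r - \<bar>y\<bar>"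
    and "sqrt 3 / 2 * r \<le> \<bar>y\<bar> \<Longrightarrow> half_width r y = (2 + sqrt 3) * (r - \<bar>y\<bar>)"
proof -
  have le1: "r - (2 - sqrt 3) * a \<le> (1 + sqrt 3) / 2 * r - a \<longleftrightarrow> a \<le> r / 2" (is ?A)
    "(1 + sqrt 3) / 2 * r - a \<le> r - (2 - sqrt 3) * a \<longleftrightarrow> r / 2 \<le> a" (is ?B) for a
  proof -
    have "(1 + sqrt 3) / 2 * r - a - (r - (2 - sqrt 3) * a) = (sqrt 3 - 1) * (r / 2 - a)"
      by (simp add: field_simps)
    moreover have "(sqrt 3 - 1) * (r / 2 - a) \<ge> 0 \<longleftrightarrow> r / 2 - a \<ge> 0"
      using sqrt3_bounds by (simp add: zero_le_mult_iff)
    moreover have "(sqrt 3 - 1) * (r / 2 - a) \<le> 0 \<longleftrightarrow> r / 2 - a \<le> 0"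
      using sqrt3_bounds by (simp add: mult_le_0_iff)
    ultimately show ?A ?B by linarith+
  qed
  have le2: "(1 + sqrt 3) / 2 * r - a \<le> (2 + sqrt 3) * (r - a) \<longleftrightarrow> a \<le> sqrt 3 / 2 * r" (is ?A)
    "(2 + sqrt 3) * (r - a) \<le> (1 + sqrt 3) / 2 * r - a \<longleftrightarrow> sqrt 3 / 2 * r \<le> a" (is ?B) for a
  proof -
    have "(2 + sqrt 3) * (r - a) - ((1 + sqrt 3) / 2 * r - a) = (1 + sqrt 3) * (sqrt 3 / 2 * r - a)"
      by (simp add: field_simps)
    moreover have "(1 + sqrt 3) * (sqrt 3 / 2 * r - a) \<ge> 0 \<longleftrightarrow> sqrt 3 / 2 * r - a \<ge> 0"
      using sqrt3_bounds by (simp add: zero_le_mult_iff)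
    moreover have "(1 + sqrt 3) * (sqrt 3 / 2 * r - a) \<le> 0 \<longleftrightarrow> sqrt 3 / 2 * r - a \<le> 0"
      using sqrt3_bounds by (simp add: mult_le_0_iff)
    ultimately show ?A ?B by linarith+
  qed
  have r: "r / 2 \<le> sqrt 3 / 2 * r"
    using mult_right_mono[of "1/2" "sqrt 3 / 2" r] sqrt3_bounds assms by simp
  show "half_width r y = r - (2 - sqrt 3) * \<bar>y\<bar>" if "\<bar>y\<bar> \<le> r / 2"
    using le1[of "\<bar>y\<bar>"] le2[of "\<bar>y\<bar>"] r that unfolding half_width_def by linarith
  show "half_width r y = (1 + sqrt 3) / 2 * r - \<bar>y\<bar>" if "r / 2 \<le> \<bar>y\<bar>" "\<bar>y\<bar> \<le> sqrt 3 / 2 * r"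
    using le1[of "\<bar>y\<bar>"] le2[of "\<bar>y\<bar>"] r that unfolding half_width_def by linarith
  show "half_width r y = (2 + sqrt 3) * (r - \<bar>y\<bar>)" if "sqrt 3 / 2 * r \<le> \<bar>y\<bar>"
    using le1[of "\<bar>y\<bar>"] le2[of "\<bar>y\<bar>"] r that unfolding half_width_def by linarith
qed

text \<open>The line integral of \<open>\<Phi> dy\<close> along the segment from \<open>(x1, y1)\<close> to \<open>(x2, y2)\<close>.\<close>
definition segment_form :: "(real \<Rightarrow> real \<Rightarrow> real) \<Rightarrow> real \<Rightarrow> real \<Rightarrow> real \<Rightarrow> real \<Rightarrow> real" where
  "segment_form \<Phi> x1 y1 x2 y2 =
    (y2 - y1) * integral {0..1} (\<lambda>t. \<Phi> ((1 - t) * x1 + t * x2) ((1 - t) * y1 + t * y2))"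

lemma segment_form_reverse: "segment_form \<Phi> x2 y2 x1 y1 = - segment_form \<Phi> x1 y1 x2 y2"
  unfolding segment_form_def
  using integral_reverse01[of "\<lambda>t. \<Phi> ((1 - t) * x1 + t * x2) ((1 - t) * y1 + t * y2)"]
  by (simp add: algebra_simps)

text \<open>Substitution \<open>y = (1 - t) * y1 + t * y2\<close>. That \<open>h\<close> follows the
  chord is stated without division, which turns each instance into a polynomial identity.\<close>

lemma integral_affine_piece:
  assumes \<Phi>: "continuous_on UNIV (\<lambda>p. \<Phi> (fst p) (snd p))" and le: "y1 < y2"
    and h: "\<And>y. y1 \<le> y \<Longrightarrow> y \<le> y2 \<Longrightarrow> (y2 - y1) * h y = (y2 - y) * x1 + (y - y1) * x2"
  shows "((\<lambda>y. \<Phi> (h y) y) has_integral segment_form \<Phi> x1 y1 x2 y2) {y1..y2}"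
proof -
  \<comment> \<open>\<open>h\<close> is known only between \<open>y1\<close> and \<open>y2\<close>;
    \<open>?l\<close> is its affine continuation, for which continuity and the substitution are
    immediate.\<close>
  let ?l = "\<lambda>y. ((y2 - y) * x1 + (y - y1) * x2) / (y2 - y1)"
  have eq: "\<Phi> (h y) y = \<Phi> (?l y) y" if "y \<in> {y1..y2}" for y
  proof -
    have "h y = ?l y" using h[of y] that le by (simp add: eq_divide_eq mult.commute)
    then show ?thesis by simp
  qed
  have "continuous_on {y1..y2} (\<lambda>y. \<Phi> (?l y) y)"
  proof -
    have "continuous_on {y1..y2} (\<lambda>y. (?l y, y))"
      using le by (intro continuous_intros) auto
    from continuous_on_compose2[OF \<Phi> this] show ?thesis by simp
  qed
  then have int: "(\<lambda>y. \<Phi> (?l y) y) integrable_on {y1..y2}"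
    by (rule integrable_continuous_interval)
  have e1: "?l ((1 - t) * y1 + t * y2) = (1 - t) * x1 + t * x2" for t
    using le by (simp add: field_simps)
  have e2: "(y2 - y1) * t + y1 = (1 - t) * y1 + t * y2" for t
    by (simp add: field_simps)
  have "((\<lambda>t. \<Phi> (?l ((y2 - y1) * t + y1)) ((y2 - y1) * t + y1)) has_integral
      (integral {y1..y2} (\<lambda>y. \<Phi> (?l y) y) / (y2 - y1))) {0..1}"
    using has_integral_affinity'[of "\<lambda>y. \<Phi> (?l y) y" _ y1 y2 "y2 - y1" y1] integrable_integral[OF int] le
    by (simp add: real_scaleR_def divide_inverse_commute)
  then have "integral {0..1} (\<lambda>t. \<Phi> ((1 - t) * x1 + t * x2) ((1 - t) * y1 + t * y2)) = integral {y1..y2} (\<lambda>y. \<Phi> (?l y) y) / (y2 - y1)"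
    unfolding e2 e1 by (rule integral_unique)
  then have "integral {y1..y2} (\<lambda>y. \<Phi> (?l y) y) = segment_form \<Phi> x1 y1 x2 y2"
    unfolding segment_form_def using le by simp
  then have "((\<lambda>y. \<Phi> (?l y) y) has_integral segment_form \<Phi> x1 y1 x2 y2) {y1..y2}"
    using integrable_integral[OF int] by simp
  then show ?thesis by (rule has_integral_eq[rotated]) (simp add: eq)
qed

text \<open>The right half of the boundary runs upwards from the lowest to the highest vertex. The
  interval is cut at the ordinates of the vertices, where \<open>half_width\<close> passes from one
  affine piece to the next.\<close>

lemma half_boundary_integral:
  assumes \<Phi>: "continuous_on UNIV (\<lambda>p. \<Phi> (fst p) (snd p))" and r: "r > 0"
  shows "((\<lambda>y. \<Phi> (half_width r y) y) has_integral
    segment_form \<Phi> 0 (-r) (r / 2) (- (sqrt 3 / 2 * r))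
    + segment_form \<Phi> (r / 2) (- (sqrt 3 / 2 * r)) (sqrt 3 / 2 * r) (- (r / 2))
    + segment_form \<Phi> (sqrt 3 / 2 * r) (- (r / 2)) r 0
    + segment_form \<Phi> r 0 (sqrt 3 / 2 * r) (r / 2)
    + segment_form \<Phi> (sqrt 3 / 2 * r) (r / 2) (r / 2) (sqrt 3 / 2 * r)
    + segment_form \<Phi> (r / 2) (sqrt 3 / 2 * r) 0 r) {-r..r}"
    (is "(_ has_integral ?S) _")
proof -
  let ?f = "\<lambda>y. \<Phi> (half_width r y) y"
  have r1: "r / 2 < sqrt 3 / 2 * r"
    using mult_strict_right_mono[of "1/2" "sqrt 3 / 2" r] sqrt3_bounds r by simp
  have r2: "sqrt 3 / 2 * r < r"
    using mult_strict_right_mono[of "sqrt 3 / 2" 1 r] sqrt3_bounds r by simp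
  note hw = half_width_cases[OF less_imp_le[OF r]]
  have hw1: "half_width r y = (2 + sqrt 3) * (r + y)" if "y \<le> - (sqrt 3 / 2 * r)" for y
    using hw(3)[of y] that r1 r by simp
  have hw2: "half_width r y = (1 + sqrt 3) / 2 * r + y" if "- (sqrt 3 / 2 * r) \<le> y" "y \<le> - (r / 2)" for y
    using hw(2)[of y] that r1 r by simp
  have hw3: "half_width r y = r + (2 - sqrt 3) * y" if "- (r / 2) \<le> y" "y \<le> 0" for y
    using hw(1)[of y] that r1 r by simp
  have hw4: "half_width r y = r - (2 - sqrt 3) * y" if "0 \<le> y" "y \<le> r / 2" for y
    using hw(1)[of y] that r1 r by simp
  have hw5: "half_width r y = (1 + sqrt 3) / 2 * r - y" if "r / 2 \<le> y" "y \<le> sqrt 3 / 2 * r" for y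
    using hw(2)[of y] that r1 r by simp
  have hw6: "half_width r y = (2 + sqrt 3) * (r - y)" if "sqrt 3 / 2 * r \<le> y" for y
    using hw(3)[of y] that r1 r by simp
  have P1: "(?f has_integral segment_form \<Phi> 0 (-r) (r / 2) (- (sqrt 3 / 2 * r))) {-r..- (sqrt 3 / 2 * r)}"
    by (rule integral_affine_piece[OF \<Phi>]; use r1 r2 r in \<open>simp add: hw1; simp add: field_simps\<close>)+
  have P2: "(?f has_integral segment_form \<Phi> (r / 2) (- (sqrt 3 / 2 * r)) (sqrt 3 / 2 * r) (- (r / 2))) {- (sqrt 3 / 2 * r)..- (r / 2)}"
    by (rule integral_affine_piece[OF \<Phi>]; use r1 r2 r in \<open>simp add: hw2; simp add: field_simps\<close>)+
  have P3: "(?f has_integral segment_form \<Phi> (sqrt 3 / 2 * r) (- (r / 2)) r 0) {- (r / 2)..0}"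
    by (rule integral_affine_piece[OF \<Phi>]; use r1 r2 r in \<open>simp add: hw3; simp add: field_simps\<close>)+
  have P4: "(?f has_integral segment_form \<Phi> r 0 (sqrt 3 / 2 * r) (r / 2)) {0..r / 2}"
    by (rule integral_affine_piece[OF \<Phi>]; use r1 r2 r in \<open>simp add: hw4; simp add: field_simps\<close>)+
  have P5: "(?f has_integral segment_form \<Phi> (sqrt 3 / 2 * r) (r / 2) (r / 2) (sqrt 3 / 2 * r)) {r / 2..sqrt 3 / 2 * r}"
    by (rule integral_affine_piece[OF \<Phi>]; use r1 r2 r in \<open>simp add: hw5; simp add: field_simps\<close>)+
  have P6: "(?f has_integral segment_form \<Phi> (r / 2) (sqrt 3 / 2 * r) 0 r) {sqrt 3 / 2 * r..r}"
    by (rule integral_affine_piece[OF \<Phi>]; use r1 r2 r in \<open>simp add: hw6; simp add: field_simps\<close>)+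
  have comb: "(?f has_integral (a + b)) {u..w}" if "(?f has_integral a) {u..v}" "(?f has_integral b) {v..w}" "u \<le> v" "v \<le> w" for a b u v w
    using has_integral_combine[OF that(3,4,1,2)] .
  show ?thesis
    by (rule comb[OF comb[OF comb[OF comb[OF comb[OF P1 P2] P3] P4] P5] P6])
      (use r r1 r2 sqrt3_bounds in auto)
qed

definition vertex :: "real \<Rightarrow> nat \<Rightarrow> complex" where
  "vertex r k = complex_of_real r * cis (real k * pi / 6)"

definition edge :: "real \<Rightarrow> nat \<Rightarrow> real \<Rightarrow> complex" where
  "edge r k t = complex_of_real (1 - t) * vertex r k + complex_of_real t * vertex r (Suc k)"

lemma vertex_add6: "vertex r (k + 6) = - vertex r k"
proof -
  have e: "real (k + 6) * pi / 6 = real k * pi / 6 + pi" by (simp add: field_simps)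
  show ?thesis unfolding vertex_def e by (simp add: complex_eq_iff)
qed

lemma vertex_values:
  "vertex r 0 = Complex r 0"
  "vertex r 1 = Complex (sqrt 3 / 2 * r) (r / 2)"
  "vertex r 2 = Complex (r / 2) (sqrt 3 / 2 * r)"
  "vertex r 3 = Complex 0 r"
  "vertex r 4 = Complex (- (r / 2)) (sqrt 3 / 2 * r)"
  "vertex r 5 = Complex (- (sqrt 3 / 2 * r)) (r / 2)"
  "vertex r 6 = Complex (- r) 0"
  "vertex r 7 = Complex (- (sqrt 3 / 2 * r)) (- (r / 2))"
  "vertex r 8 = Complex (- (r / 2)) (- (sqrt 3 / 2 * r))"
  "vertex r 9 = Complex 0 (- r)"
  "vertex r 10 = Complex (r / 2) (- (sqrt 3 / 2 * r))"
  "vertex r 11 = Complex (sqrt 3 / 2 * r) (- (r / 2))"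
  "vertex r 12 = Complex r 0"
proof -
  have e: "4 * pi / 6 = pi - pi / 3" "5 * pi / 6 = pi - pi / 6" "2 * pi / 6 = pi / 3" "3 * pi / 6 = pi / 2"
    by simp_all
  have v0: "vertex r 0 = Complex r 0"
    unfolding vertex_def by (simp add: complex_eq_iff)
  have v1: "vertex r 1 = Complex (sqrt 3 / 2 * r) (r / 2)"
    unfolding vertex_def by (simp add: complex_eq_iff cos_30 sin_30)
  have v2: "vertex r 2 = Complex (r / 2) (sqrt 3 / 2 * r)"
    unfolding vertex_def by (simp add: complex_eq_iff cos_60 sin_60 e del: mult_divide_mult_cancel_left_if)
  have v3: "vertex r 3 = Complex 0 r"
    unfolding vertex_def by (simp add: complex_eq_iff e del: mult_divide_mult_cancel_left_if)
  have v4: "vertex r 4 = Complex (- (r / 2)) (sqrt 3 / 2 * r)"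
    unfolding vertex_def by (simp add: complex_eq_iff cos_120 sin_120)
  have v5: "vertex r 5 = Complex (- (sqrt 3 / 2 * r)) (r / 2)"
  proof -
    have c: "cos (pi - pi / 6) = - (sqrt 3 / 2)" "sin (pi - pi / 6) = 1 / 2"
      by (simp_all only: cos_pi_minus sin_pi_minus cos_30 sin_30)
    show ?thesis unfolding vertex_def of_nat_numeral e by (simp only: complex_eq_iff cis.sel c complex.sel Re_complex_of_real Im_complex_of_real times_complex.sel) simp
  qed
  have v6: "vertex r 6 = Complex (- r) 0" using vertex_add6[of r 0] by (simp add: v0 complex_eq_iff)
  note v = v0 v1 v2 v3 v4 v5 v6
  show "vertex r 0 = Complex r 0"
  "vertex r 1 = Complex (sqrt 3 / 2 * r) (r / 2)"
  "vertex r 2 = Complex (r / 2) (sqrt 3 / 2 * r)"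
  "vertex r 3 = Complex 0 r"
  "vertex r 4 = Complex (- (r / 2)) (sqrt 3 / 2 * r)"
  "vertex r 5 = Complex (- (sqrt 3 / 2 * r)) (r / 2)"
  "vertex r 6 = Complex (- r) 0" by fact+
  show
  "vertex r 7 = Complex (- (sqrt 3 / 2 * r)) (- (r / 2))"
  "vertex r 8 = Complex (- (r / 2)) (- (sqrt 3 / 2 * r))"
  "vertex r 9 = Complex 0 (- r)"
  "vertex r 10 = Complex (r / 2) (- (sqrt 3 / 2 * r))"
  "vertex r 11 = Complex (sqrt 3 / 2 * r) (- (r / 2))"
  "vertex r 12 = Complex r 0"
    using vertex_add6[of r 1] vertex_add6[of r 2] vertex_add6[of r 3] vertex_add6[of r 4] vertex_add6[of r 5] vertex_add6[of r 6]
    by (simp_all add: v v1[simplified] complex_eq_iff)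
qed

lemma sum_lessThan_12:
  "(\<Sum>k<12. f k) = f 0 + f 1 + f 2 + f 3 + f 4 + f 5 + f 6 + f 7 + f 8 + f 9 + f 10 + f (11::nat)"
  for f :: "nat \<Rightarrow> 'a::comm_monoid_add"
  by (simp add: eval_nat_numeral)

text \<open>The left half of the boundary is the mirror image of the right half and is also passed
  upwards, hence the difference. The right-hand sides read the same curve in two ways: with the
  abscissa as first argument of \<open>\<Phi>\<close>, counterclockwise, and with the coordinates
  exchanged, which reverses the orientation and causes the minus sign.\<close>

lemma full_boundary_integral:
  assumes \<Phi>: "continuous_on UNIV (\<lambda>p. \<Phi> (fst p) (snd p))" and r: "r > 0"
  shows "integral {-r..r} (\<lambda>y. \<Phi> (half_width r y) y - \<Phi> (- half_width r y) y) =
      (\<Sum>k<12. segment_form \<Phi> (Re (vertex r k)) (Im (vertex r k)) (Re (vertex r (Suc k))) (Im (vertex r (Suc k))))"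
    "integral {-r..r} (\<lambda>y. \<Phi> (half_width r y) y - \<Phi> (- half_width r y) y) =
      - (\<Sum>k<12. segment_form \<Phi> (Im (vertex r k)) (Re (vertex r k)) (Im (vertex r (Suc k))) (Re (vertex r (Suc k))))"
proof -
  let ?S = "segment_form \<Phi>"
  let ?b = "sqrt 3 / 2 * r"
  have \<Phi>': "continuous_on UNIV (\<lambda>p. \<Phi> (- fst p) (snd p))"
  proof -
    have "continuous_on UNIV (\<lambda>p::real \<times> real. (- fst p, snd p))" by (intro continuous_intros)
    from continuous_on_compose2[OF \<Phi> this] show ?thesis by simp
  qed
  have neg: "segment_form (\<lambda>a. \<Phi> (- a)) x1 y1 x2 y2 = ?S (- x1) y1 (- x2) y2" for x1 y1 x2 y2
    unfolding segment_form_def by (simp add: algebra_simps)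
  note d = has_integral_diff[OF half_boundary_integral[OF \<Phi> r] half_boundary_integral[where \<Phi> = "\<lambda>a. \<Phi> (- a)", OF \<Phi>' r]]
  note d' = integral_unique[OF d, unfolded neg minus_zero]
  \<comment> \<open>In the first equation the segments on the left have to be turned round, in the
    second those on the right.\<close>
  note rev = segment_form_reverse[of \<Phi> "-r" 0 "- ?b" "r / 2"] segment_form_reverse[of \<Phi> "- ?b" "r / 2" "-(r/2)" "?b"]
    segment_form_reverse[of \<Phi> "-(r/2)" "?b" 0 r] segment_form_reverse[of \<Phi> "-r" 0 "- ?b" "- (r / 2)"]
    segment_form_reverse[of \<Phi> "- ?b" "- (r / 2)" "-(r/2)" "- ?b"] segment_form_reverse[of \<Phi> "-(r/2)" "- ?b" 0 "-r"]
    segment_form_reverse[of \<Phi> "r" 0 "?b" "r / 2"] segment_form_reverse[of \<Phi> "?b" "r / 2" "r/2" "?b"]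
    segment_form_reverse[of \<Phi> "r/2" "?b" 0 r] segment_form_reverse[of \<Phi> "r" 0 "?b" "- (r / 2)"]
    segment_form_reverse[of \<Phi> "?b" "- (r / 2)" "r/2" "- ?b"] segment_form_reverse[of \<Phi> "r/2" "- ?b" 0 "-r"]
  have S: "Suc 0 = 1" "Suc 1 = 2" "Suc 2 = 3" "Suc 3 = 4" "Suc 4 = 5" "Suc 5 = 6" "Suc 6 = 7" "Suc 7 = 8" "Suc 8 = 9"
    "Suc 9 = 10" "Suc 10 = 11" "Suc 11 = 12" by simp_all
  show "integral {-r..r} (\<lambda>y. \<Phi> (half_width r y) y - \<Phi> (- half_width r y) y) =
      (\<Sum>k<12. ?S (Re (vertex r k)) (Im (vertex r k)) (Re (vertex r (Suc k))) (Im (vertex r (Suc k))))"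
    unfolding d' sum_lessThan_12 S vertex_values complex.sel using rev by linarith
  show "integral {-r..r} (\<lambda>y. \<Phi> (half_width r y) y - \<Phi> (- half_width r y) y) =
      - (\<Sum>k<12. ?S (Im (vertex r k)) (Re (vertex r k)) (Im (vertex r (Suc k))) (Re (vertex r (Suc k))))"
    unfolding d' sum_lessThan_12 S vertex_values complex.sel using rev by linarith
qed

lemma integral_dodecagon_partial_x:
  fixes f g :: "complex \<Rightarrow> real"
  assumes r: "r > 0" and f: "continuous_on UNIV f" and g: "continuous_on UNIV g"
    and deriv: "\<And>x y. Complex x y \<noteq> w \<Longrightarrow> ((\<lambda>x. g (Complex x y)) has_real_derivative f (Complex x y)) (at x)"
  shows "(\<integral>z. indicator (dodecagon r) z * f z \<partial>lborel) =
    (\<Sum>k<12. Im (vertex r (Suc k) - vertex r k) * integral {0..1} (\<lambda>t. g (edge r k t)))"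
proof -
  have c: "continuous_on UNIV (\<lambda>p. g (Complex (fst p) (snd p)))"
    by (rule continuous_on_compose2[OF g continuous_Complex2]) auto
  have e: "Complex ((1 - t) * Re (vertex r k) + t * Re (vertex r (Suc k))) ((1 - t) * Im (vertex r k) + t * Im (vertex r (Suc k))) = edge r k t" for k t
    by (simp add: edge_def complex_eq_iff)
  have sect: "(\<integral>z. indicator (dodecagon r) z * f z \<partial>lborel) = integral {-r..r} (\<lambda>y. g (Complex (half_width r y) y) - g (Complex (- half_width r y) y))"
    by (rule horizontal_section[OF f g]) (rule deriv)
  show ?thesis
    unfolding sect full_boundary_integral(1)[where \<Phi> = "\<lambda>a b. g (Complex a b)", OF c r]
      segment_form_def e by simp
qed

text \<open>Counterclockwise, Green's formula has \<open>- g dx\<close> here in place of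
  \<open>g dy\<close>. Exchanging the arguments of \<open>\<Phi>\<close> brings in this sign through
  the reversed orientation.\<close>

lemma integral_dodecagon_partial_y:
  fixes f g :: "complex \<Rightarrow> real"
  assumes r: "r > 0" and f: "continuous_on UNIV f" and g: "continuous_on UNIV g"
    and deriv: "\<And>x y. Complex x y \<noteq> w \<Longrightarrow> ((\<lambda>y. g (Complex x y)) has_real_derivative f (Complex x y)) (at y)"
  shows "(\<integral>z. indicator (dodecagon r) z * f z \<partial>lborel) =
    - (\<Sum>k<12. Re (vertex r (Suc k) - vertex r k) * integral {0..1} (\<lambda>t. g (edge r k t)))"
proof -
  have "continuous_on UNIV (\<lambda>p::real \<times> real. (snd p, fst p))" by (intro continuous_intros)
  from continuous_on_compose2[OF continuous_Complex2 this] have "continuous_on UNIV (\<lambda>p. Complex (snd p) (fst p))" by simp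
  then have c: "continuous_on UNIV (\<lambda>p. g (Complex (snd p) (fst p)))"
    by (rule continuous_on_compose2[OF g]) auto
  have e: "Complex ((1 - t) * Re (vertex r k) + t * Re (vertex r (Suc k))) ((1 - t) * Im (vertex r k) + t * Im (vertex r (Suc k))) = edge r k t" for k t
    by (simp add: edge_def complex_eq_iff)
  have sect: "(\<integral>z. indicator (dodecagon r) z * f z \<partial>lborel) = integral {-r..r} (\<lambda>y. g (Complex y (half_width r y)) - g (Complex y (- half_width r y)))"
    by (rule vertical_section[OF f g]) (rule deriv)
  show ?thesis
    unfolding sect full_boundary_integral(2)[where \<Phi> = "\<lambda>a b. g (Complex b a)", OF c r]
      segment_form_def e by simp
qed

subsection \<open>Reduction to pairs of sides\<close>

lemma square_div_le:
  fixes a n :: real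
  assumes "\<bar>a\<bar> \<le> n"
  shows "a\<^sup>2 / n \<le> n"
proof -
  have "a\<^sup>2 \<le> n\<^sup>2" using power_mono[OF assms abs_ge_zero, of 2] by simp
  moreover have "n \<ge> 0" using assms by linarith
  ultimately show ?thesis
    using divide_right_mono[of "a\<^sup>2" "n\<^sup>2" n] by (simp add: power2_eq_square split: if_splits)
qed

text \<open>At 0 the quotient is 0 by the convention for division, and this is also its limit,
  because the quotient is at most \<open>norm z\<close>. The partial derivatives of
  \<open>Re z * cmod z\<close> and \<open>Im z * cmod z\<close> contain such terms.\<close>

lemma continuous_square_over_norm:
  fixes u :: "complex \<Rightarrow> real"
  assumes u: "continuous_on UNIV u" and le: "\<And>z. \<bar>u z\<bar> \<le> norm z"
  shows "continuous_on UNIV (\<lambda>z. (u z)\<^sup>2 / norm z)"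
proof -
  have "isCont (\<lambda>z. (u z)\<^sup>2 / norm z) z" for z
  proof (cases "z = 0")
    case False
    have "isCont u z" using u by (simp add: continuous_on_eq_continuous_at)
    then show ?thesis using False by (intro continuous_intros) auto
  next
    case True
    have bound: "norm ((u z)\<^sup>2 / norm z) \<le> norm z" for z
      using square_div_le[OF le[of z]] by simp
    have lim: "(norm \<longlongrightarrow> 0) (at (0::complex))"
      using tendsto_norm[OF tendsto_ident_at, of "0::complex" UNIV] by simp
    have "((\<lambda>z. (u z)\<^sup>2 / norm z) \<longlongrightarrow> 0) (at 0)"
      by (rule Lim_null_comparison[OF always_eventually lim]) (rule allI, rule bound)
    then show ?thesis using True by (simp add: isCont_def)
  qed
  then show ?thesis by (simp add: continuous_on_eq_continuous_at)
qed

text \<open>When \<open>v\<close> is a side vector of a polygon passed counterclockwise, this is the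
  inner product of \<open>u\<close> with the outward normal of the same length as
  \<open>v\<close>.\<close>

definition cross :: "complex \<Rightarrow> complex \<Rightarrow> real" where
  "cross u v = Re u * Im v - Im u * Re v"

definition side :: "real \<Rightarrow> nat \<Rightarrow> complex" where
  "side r k = vertex r (Suc k) - vertex r k"

lemma continuous_edge: "continuous_on S (edge r k)"
  unfolding edge_def[abs_def] by (intro continuous_intros)

lemma cmod_Complex_diff: "cmod (Complex x y - p) = sqrt ((x - Re p)\<^sup>2 + (y - Im p)\<^sup>2)"
proof -
  have "Complex x y - p = Complex (x - Re p) (y - Im p)" by (rule complex_eqI) simp_all
  then show ?thesis by (simp only: complex_norm)
qed

lemma Complex_neq_pos: "Complex x y \<noteq> p \<Longrightarrow> (x - Re p)\<^sup>2 + (y - Im p)\<^sup>2 > 0"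
proof -
  assume "Complex x y \<noteq> p"
  then have "x - Re p \<noteq> 0 \<or> y - Im p \<noteq> 0" by (cases p) simp
  then show ?thesis by (simp only: sum_power2_gt_zero_iff)
qed

lemma deriv_norm_x:
  assumes "Complex x y \<noteq> p"
  shows "((\<lambda>x. cmod (Complex x y - p)) has_real_derivative (x - Re p) / cmod (Complex x y - p)) (at x)"
proof -
  have "((\<lambda>x. (x - Re p)\<^sup>2 + (y - Im p)\<^sup>2) has_real_derivative 2 * (x - Re p)) (at x)"
    by (auto intro!: derivative_eq_intros)
  from DERIV_chain2[where f = sqrt and g = "\<lambda>x. (x - Re p)\<^sup>2 + (y - Im p)\<^sup>2", OF DERIV_real_sqrt[OF Complex_neq_pos[OF assms]] this]
  have "((\<lambda>x. sqrt ((x - Re p)\<^sup>2 + (y - Im p)\<^sup>2)) has_real_derivative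
      inverse (sqrt ((x - Re p)\<^sup>2 + (y - Im p)\<^sup>2)) / 2 * (2 * (x - Re p))) (at x)" .
  moreover have "inverse s / 2 * (2 * w) = w / s" for s w :: real
    by (cases "s = 0") (simp_all add: field_simps)
  ultimately show ?thesis unfolding cmod_Complex_diff by (simp only:)
qed

lemma deriv_norm_y:
  assumes "Complex x y \<noteq> p"
  shows "((\<lambda>y. cmod (Complex x y - p)) has_real_derivative (y - Im p) / cmod (Complex x y - p)) (at y)"
proof -
  have "((\<lambda>y. (x - Re p)\<^sup>2 + (y - Im p)\<^sup>2) has_real_derivative 2 * (y - Im p)) (at y)"
    by (auto intro!: derivative_eq_intros)
  from DERIV_chain2[where f = sqrt and g = "\<lambda>y. (x - Re p)\<^sup>2 + (y - Im p)\<^sup>2", OF DERIV_real_sqrt[OF Complex_neq_pos[OF assms]] this]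
  have "((\<lambda>y. sqrt ((x - Re p)\<^sup>2 + (y - Im p)\<^sup>2)) has_real_derivative
      inverse (sqrt ((x - Re p)\<^sup>2 + (y - Im p)\<^sup>2)) / 2 * (2 * (y - Im p))) (at y)" .
  moreover have "inverse s / 2 * (2 * w) = w / s" for s w :: real
    by (cases "s = 0") (simp_all add: field_simps)
  ultimately show ?thesis unfolding cmod_Complex_diff by (simp only:)
qed

lemma integral_dodecagon_norm:
  assumes r: "r > 0"
  shows "(\<integral>z. indicator (dodecagon r) z * cmod (z - p) \<partial>lborel) =
    (\<Sum>k<12. integral {0..1} (\<lambda>t. cmod (edge r k t - p) / 3 * cross (edge r k t - p) (side r k)))"
proof -
  \<comment> \<open>\<open>q Re\<close> and \<open>q Im\<close> are the two partial derivatives that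
    make up the divergence of \<open>(z - p) * cmod (z - p) / 3\<close>. In their sum, two thirds of
    \<open>cmod (z - p)\<close> come from the norms and one third from the quotients.\<close>
  define q where "q = (\<lambda>u::complex \<Rightarrow> real. \<lambda>z. (cmod (z - p) + (u (z - p))\<^sup>2 / cmod (z - p)) / 3)"
  have shift: "continuous_on UNIV (\<lambda>z. z - p)" by (intro continuous_intros)
  have cq: "continuous_on UNIV (q u)" if "continuous_on UNIV u" "\<And>z. \<bar>u z\<bar> \<le> norm z" for u
  proof -
    have "continuous_on UNIV (\<lambda>z. (u (z - p))\<^sup>2 / cmod (z - p))"
      by (rule continuous_on_compose2[OF continuous_square_over_norm[OF that] shift]) auto
    then show ?thesis unfolding q_def by (rule continuous_on_divide[OF continuous_on_add[OF continuous_on_norm[OF shift]]]) auto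
  qed
  have cRe: "continuous_on UNIV (q Re)" by (rule cq[OF continuous_on_Re[OF continuous_on_id] abs_Re_le_cmod])
  have cIm: "continuous_on UNIV (q Im)" by (rule cq[OF continuous_on_Im[OF continuous_on_id] abs_Im_le_cmod])
  have sum: "cmod (z - p) = q Re z + q Im z" for z
  proof (cases "z = p")
    case False
    have "(Re (z - p))\<^sup>2 / cmod (z - p) + (Im (z - p))\<^sup>2 / cmod (z - p) = cmod (z - p)"
      unfolding add_divide_distrib[symmetric] cmod_power2[symmetric] using False by (simp add: power2_eq_square)
    moreover have "c = (c + a) / 3 + (c + b) / 3" if "a + b = c" for a b c :: real
      using that by (simp add: field_simps)
    ultimately show ?thesis unfolding q_def by blast
  qed (simp add: q_def)
  have "(\<integral>z. indicator (dodecagon r) z * cmod (z - p) \<partial>lborel) =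
      (\<integral>z. indicator (dodecagon r) z * q Re z \<partial>lborel) + (\<integral>z. indicator (dodecagon r) z * q Im z \<partial>lborel)"
  proof -
    have "(\<integral>z. indicator (dodecagon r) z * cmod (z - p) \<partial>lborel) =
        (\<integral>z. indicator (dodecagon r) z * q Re z + indicator (dodecagon r) z * q Im z \<partial>lborel)"
      by (rule Bochner_Integration.integral_cong[OF refl]) (simp only: sum distrib_left)
    then show ?thesis
      using Bochner_Integration.integral_add[OF integrable_dodecagon(1)[OF cRe] integrable_dodecagon(1)[OF cIm], of r r] by simp
  qed
  also have "(\<integral>z. indicator (dodecagon r) z * q Re z \<partial>lborel) =
      (\<Sum>k<12. Im (vertex r (Suc k) - vertex r k) * integral {0..1} (\<lambda>t. Re (edge r k t - p) * cmod (edge r k t - p) / 3))"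
  proof (rule integral_dodecagon_partial_x[OF r cRe, where w = p and g = "\<lambda>z. Re (z - p) * cmod (z - p) / 3"])
    fix x y assume a: "Complex x y \<noteq> p"
    show "((\<lambda>x. Re (Complex x y - p) * cmod (Complex x y - p) / 3) has_real_derivative q Re (Complex x y)) (at x)"
    proof -
      have "((\<lambda>x. x - Re p) has_real_derivative 1) (at x)" by (auto intro!: derivative_eq_intros)
      from DERIV_cdivide[OF DERIV_mult[OF this deriv_norm_x[OF a]], of 3]
      show ?thesis unfolding q_def by (simp add: power2_eq_square add.commute)
    qed
  qed (intro continuous_intros, auto)
  also have "(\<integral>z. indicator (dodecagon r) z * q Im z \<partial>lborel) =
      - (\<Sum>k<12. Re (vertex r (Suc k) - vertex r k) * integral {0..1} (\<lambda>t. Im (edge r k t - p) * cmod (edge r k t - p) / 3))"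
  proof (rule integral_dodecagon_partial_y[OF r cIm, where w = p and g = "\<lambda>z. Im (z - p) * cmod (z - p) / 3"])
    fix x y assume a: "Complex x y \<noteq> p"
    show "((\<lambda>y. Im (Complex x y - p) * cmod (Complex x y - p) / 3) has_real_derivative q Im (Complex x y)) (at y)"
    proof -
      have "((\<lambda>y. y - Im p) has_real_derivative 1) (at y)" by (auto intro!: derivative_eq_intros)
      from DERIV_cdivide[OF DERIV_mult[OF this deriv_norm_y[OF a]], of 3]
      show ?thesis unfolding q_def by (simp add: power2_eq_square add.commute)
    qed
  qed (intro continuous_intros, auto)
  also have "(\<Sum>k<12. Im (vertex r (Suc k) - vertex r k) * integral {0..1} (\<lambda>t. Re (edge r k t - p) * cmod (edge r k t - p) / 3)) +
      - (\<Sum>k<12. Re (vertex r (Suc k) - vertex r k) * integral {0..1} (\<lambda>t. Im (edge r k t - p) * cmod (edge r k t - p) / 3)) =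
      (\<Sum>k<12. integral {0..1} (\<lambda>t. cmod (edge r k t - p) / 3 * cross (edge r k t - p) (side r k)))"
    unfolding add_uminus_conv_diff sum_subtractf[symmetric]
  proof (rule sum.cong[OF refl])
    fix k
    have i: "(\<lambda>t. Re (edge r k t - p) * cmod (edge r k t - p) / 3) integrable_on {0..1}"
        "(\<lambda>t. Im (edge r k t - p) * cmod (edge r k t - p) / 3) integrable_on {0..1}"
      by (auto intro!: integrable_continuous_interval continuous_intros continuous_edge)
    have "((\<lambda>t. Im (side r k) * (Re (edge r k t - p) * cmod (edge r k t - p) / 3) - Re (side r k) * (Im (edge r k t - p) * cmod (edge r k t - p) / 3))
      has_integral (Im (side r k) * integral {0..1} (\<lambda>t. Re (edge r k t - p) * cmod (edge r k t - p) / 3) -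
      Re (side r k) * integral {0..1} (\<lambda>t. Im (edge r k t - p) * cmod (edge r k t - p) / 3))) {0..1}"
      using i by (intro has_integral_diff has_integral_mult_right integrable_integral)
    note int = integral_unique[OF this]
    show "Im (vertex r (Suc k) - vertex r k) * integral {0..1} (\<lambda>t. Re (edge r k t - p) * cmod (edge r k t - p) / 3) -
      Re (vertex r (Suc k) - vertex r k) * integral {0..1} (\<lambda>t. Im (edge r k t - p) * cmod (edge r k t - p) / 3) =
      integral {0..1} (\<lambda>t. cmod (edge r k t - p) / 3 * cross (edge r k t - p) (side r k))"
    proof -
      have pointwise: "Im (side r k) * (Re (edge r k t - p) * cmod (edge r k t - p) / 3) - Re (side r k) * (Im (edge r k t - p) * cmod (edge r k t - p) / 3)
        = cmod (edge r k t - p) / 3 * cross (edge r k t - p) (side r k)" for t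
      proof -
        have alg: "a * (b * n / 3) - c * (e * n / 3) = n / 3 * (b * a - e * c)" for a b c e n :: real
          by (simp add: field_simps)
        show ?thesis unfolding cross_def by (rule alg)
      qed
      show ?thesis by (simp only: side_def[symmetric] int[symmetric] pointwise)
    qed
  qed
  finally show ?thesis .
qed

text \<open>Here \<open>p\<close> will be a point of a side with vector \<open>d\<close>, and
  \<open>z\<close> the point that is still in the area. Both components of
  \<open>cmod (z - p) * (z - p)\<close> are partial derivatives of
  \<open>cmod (z - p) ^ 3 / 3\<close>. The cross product pairs vertical increments with
  \<open>Im d\<close> and horizontal ones with \<open>Re d\<close>, which adds up to an inner
  product; the factor is 1/3 from each integration and a sign from \<open>p - z\<close>.\<close>

lemma integral_dodecagon_norm_cross:
  assumes r: "r > 0"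
  shows "(\<integral>z. indicator (dodecagon r) z * (cmod (p - z) / 3 * cross (p - z) d) \<partial>lborel) =
    - (1 / 9) * (\<Sum>j<12. (side r j \<bullet> d) * integral {0..1} (\<lambda>s. cmod (p - edge r j s) ^ 3))"
proof -
  define F where "F = (\<lambda>u::complex \<Rightarrow> real. \<lambda>z. cmod (z - p) * u (z - p))"
  define G where "G = (\<lambda>z. cmod (z - p) ^ 3 / 3)"
  have cF: "continuous_on UNIV (F Re)" "continuous_on UNIV (F Im)"
    unfolding F_def by (intro continuous_intros)+
  have cG: "continuous_on UNIV G"
    unfolding G_def by (intro continuous_intros) auto
  have G_integral: "3 * integral {0..1} (\<lambda>s. G (edge r j s)) = integral {0..1} (\<lambda>s. cmod (p - edge r j s) ^ 3)" for j
  proof -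
    have "G (edge r j s) = cmod (p - edge r j s) ^ 3 / 3" for s
      unfolding G_def norm_minus_commute[of p] ..
    then show ?thesis by (simp only:) simp
  qed
  have X: "(\<integral>z. indicator (dodecagon r) z * F Re z \<partial>lborel) =
      (\<Sum>k<12. Im (vertex r (Suc k) - vertex r k) * integral {0..1} (\<lambda>t. G (edge r k t)))"
  proof (rule integral_dodecagon_partial_x[OF r cF(1) cG, where w = p])
    fix x y assume a: "Complex x y \<noteq> p"
    show "((\<lambda>x. G (Complex x y)) has_real_derivative F Re (Complex x y)) (at x)"
      using DERIV_cdivide[OF DERIV_power[OF deriv_norm_x[OF a], of 3], of 3] a
      unfolding F_def G_def by (simp add: power2_eq_square mult.commute)
  qed
  have Y: "(\<integral>z. indicator (dodecagon r) z * F Im z \<partial>lborel) =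
      - (\<Sum>k<12. Re (vertex r (Suc k) - vertex r k) * integral {0..1} (\<lambda>t. G (edge r k t)))"
  proof (rule integral_dodecagon_partial_y[OF r cF(2) cG, where w = p])
    fix x y assume a: "Complex x y \<noteq> p"
    show "((\<lambda>y. G (Complex x y)) has_real_derivative F Im (Complex x y)) (at y)"
      using DERIV_cdivide[OF DERIV_power[OF deriv_norm_y[OF a], of 3], of 3] a
      unfolding F_def G_def by (simp add: power2_eq_square mult.commute)
  qed
  have "(\<integral>z. indicator (dodecagon r) z * (cmod (p - z) / 3 * cross (p - z) d) \<partial>lborel) =
      (\<integral>z. (- Im d / 3) * (indicator (dodecagon r) z * F Re z) + (Re d / 3) * (indicator (dodecagon r) z * F Im z) \<partial>lborel)"
  proof (rule Bochner_Integration.integral_cong[OF refl])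
    fix z
    have alg: "i * (n / 3 * (- a * c - - b * e)) = (- c / 3) * (i * (n * a)) + (e / 3) * (i * (n * b))" for i n a b c e :: real
      by (simp add: field_simps)
    have neg: "Re (p - z) = - Re (z - p)" "Im (p - z) = - Im (z - p)" by simp_all
    show "indicator (dodecagon r) z * (cmod (p - z) / 3 * cross (p - z) d) =
      (- Im d / 3) * (indicator (dodecagon r) z * F Re z) + (Re d / 3) * (indicator (dodecagon r) z * F Im z)"
      unfolding F_def cross_def norm_minus_commute[of p z] neg by (rule alg)
  qed
  also have "\<dots> = (- Im d / 3) * (\<integral>z. indicator (dodecagon r) z * F Re z \<partial>lborel) + (Re d / 3) * (\<integral>z. indicator (dodecagon r) z * F Im z \<partial>lborel)"
    using integrable_dodecagon(1)[OF cF(1), of r] integrable_dodecagon(1)[OF cF(2), of r]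
    by (subst Bochner_Integration.integral_add) auto
  also have "\<dots> = - (1 / 9) * (\<Sum>j<12. (side r j \<bullet> d) * (3 * integral {0..1} (\<lambda>s. G (edge r j s))))"
  proof -
    have lin: "a * (\<Sum>k<12. u k) + b * - (\<Sum>k<12. v k) = (\<Sum>k<12. a * u k - b * v k)" for a b and u v :: "nat \<Rightarrow> real"
      by (simp add: sum_distrib_left sum_subtractf)
    show ?thesis
      unfolding X Y inner_complex_def side_def lin
      unfolding sum_distrib_left
    proof (rule sum.cong[OF refl])
      fix k
      have alg: "- c / 3 * (i * g) - e / 3 * (s * g) = - (1 / 9) * ((s * e + i * c) * (3 * g))" for c e i s g :: real
        by (simp add: field_simps)
      show "- Im d / 3 * (Im (vertex r (Suc k) - vertex r k) * integral {0..1} (\<lambda>t. G (edge r k t))) -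
          Re d / 3 * (Re (vertex r (Suc k) - vertex r k) * integral {0..1} (\<lambda>t. G (edge r k t))) =
          - (1 / 9) * ((Re (vertex r (Suc k) - vertex r k) * Re d + Im (vertex r (Suc k) - vertex r k) * Im d) *
          (3 * integral {0..1} (\<lambda>s. G (edge r k s))))"
        by (rule alg)
    qed
  qed
  finally show ?thesis unfolding G_integral .
qed

text \<open>Fubini for one point in the area and one on a side. It leaves an area integral for a
  fixed boundary point, to which the divergence theorem applies a second time.\<close>

lemma integral_dodecagon_swap:
  fixes h :: "complex \<Rightarrow> real \<Rightarrow> real"
  assumes h: "continuous_on UNIV (\<lambda>p. h (fst p) (snd p))"
  shows "(\<integral>y. indicator (dodecagon r) y * integral {0..1} (h y) \<partial>lborel) =
    (\<integral>t. indicator {0..1} t * (\<integral>y. indicator (dodecagon r) y * h y t \<partial>lborel) \<partial>lborel)"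
proof -
  have c: "continuous_on {0..1} (h y)" for y
  proof -
    have "continuous_on {0..1::real} (\<lambda>t. (y, t))" by (intro continuous_intros)
    from continuous_on_compose2[OF h this] show ?thesis by simp
  qed
  let ?k = "\<lambda>y t. indicator (dodecagon r) y * (indicator {0..1} t * h y t)"
  have int: "integrable (lborel \<Otimes>\<^sub>M lborel) (case_prod ?k)"
  proof -
    have "integrable lborel (\<lambda>p. indicator (dodecagon r \<times> {0..1}) p *\<^sub>R h (fst p) (snd p))"
      by (rule borel_integrable_compact[OF compact_Times[OF compact_dodecagon compact_Icc]])
        (rule continuous_on_subset[OF h], simp)
    then show ?thesis
      unfolding lborel_prod by (simp add: case_prod_beta' indicator_times mult.assoc)
  qed
  have "(\<integral>y. indicator (dodecagon r) y * integral {0..1} (h y) \<partial>lborel) = (\<integral>y. (\<integral>t. ?k y t \<partial>lborel) \<partial>lborel)"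
    by (simp add: integral_indicator_interval[OF c])
  also have "\<dots> = (\<integral>t. (\<integral>y. ?k y t \<partial>lborel) \<partial>lborel)"
    using lborel_pair.Fubini_integral[OF int] by simp
  also have "\<dots> = (\<integral>t. indicator {0..1} t * (\<integral>y. indicator (dodecagon r) y * h y t \<partial>lborel) \<partial>lborel)"
  proof (rule Bochner_Integration.integral_cong[OF refl])
    fix t
    have "(\<integral>y. ?k y t \<partial>lborel) = (\<integral>y. indicator {0..1} t * (indicator (dodecagon r) y * h y t) \<partial>lborel)"
      by (rule Bochner_Integration.integral_cong[OF refl]) simp
    then show "(\<integral>y. ?k y t \<partial>lborel) = indicator {0..1} t * (\<integral>y. indicator (dodecagon r) y * h y t \<partial>lborel)"
      by simp
  qed
  finally show ?thesis .
qed

lemma double_integral_dodecagon_norm: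
  assumes r: "r > 0"
  shows "(\<integral>y. indicator (dodecagon r) y * (\<integral>z. indicator (dodecagon r) z * cmod (z - y) \<partial>lborel) \<partial>lborel) =
    - (1 / 9) * (\<Sum>k<12. \<Sum>j<12. (side r j \<bullet> side r k) *
        integral {0..1} (\<lambda>t. integral {0..1} (\<lambda>s. cmod (edge r k t - edge r j s) ^ 3)))"
proof -
  let ?h = "\<lambda>k y t. cmod (edge r k t - y) / 3 * cross (edge r k t - y) (side r k)"
  have h: "continuous_on UNIV (\<lambda>p. ?h k (fst p) (snd p))" for k
    unfolding cross_def edge_def by (intro continuous_intros) auto
  have cI: "continuous_on UNIV (\<lambda>y. integral {0..1} (?h k y))" for k
  proof -
    have "continuous_on (UNIV \<times> cbox 0 1) (\<lambda>(y, t). ?h k y t)"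
      using continuous_on_subset[OF h] by (simp add: case_prod_beta')
    from integral_continuous_on_param[OF this] show ?thesis by simp
  qed
  have cJ: "continuous_on {0..1} (\<lambda>t. integral {0..1} (\<lambda>s. cmod (edge r k t - edge r j s) ^ 3))" for k j
  proof -
    have "continuous_on ({0..1} \<times> cbox 0 1) (\<lambda>(t, s). cmod (edge r k t - edge r j s) ^ 3)"
      unfolding case_prod_beta' edge_def by (intro continuous_intros)
    from integral_continuous_on_param[OF this] show ?thesis by simp
  qed
  have "(\<integral>y. indicator (dodecagon r) y * (\<integral>z. indicator (dodecagon r) z * cmod (z - y) \<partial>lborel) \<partial>lborel) =
     (\<integral>y. (\<Sum>k<12. indicator (dodecagon r) y * integral {0..1} (?h k y)) \<partial>lborel)"
    unfolding integral_dodecagon_norm[OF r] sum_distrib_left ..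
  also have "\<dots> = (\<Sum>k<12. (\<integral>y. indicator (dodecagon r) y * integral {0..1} (?h k y) \<partial>lborel))"
    by (rule Bochner_Integration.integral_sum) (rule integrable_dodecagon[OF cI])
  also have "\<dots> = (\<Sum>k<12. - (1 / 9) * (\<Sum>j<12. (side r j \<bullet> side r k) *
      integral {0..1} (\<lambda>t. integral {0..1} (\<lambda>s. cmod (edge r k t - edge r j s) ^ 3))))"
  proof (rule sum.cong[OF refl])
    fix k
    have "(\<integral>y. indicator (dodecagon r) y * integral {0..1} (?h k y) \<partial>lborel) =
        (\<integral>t. indicator {0..1} t * (\<integral>y. indicator (dodecagon r) y * ?h k y t \<partial>lborel) \<partial>lborel)"
      by (rule integral_dodecagon_swap[OF h])
    also have "\<dots> = integral {0..1} (\<lambda>t. - (1 / 9) * (\<Sum>j<12. (side r j \<bullet> side r k) *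
        integral {0..1} (\<lambda>s. cmod (edge r k t - edge r j s) ^ 3)))"
      unfolding integral_dodecagon_norm_cross[OF r]
      by (intro integral_indicator_interval continuous_intros cJ)
    also have "\<dots> = - (1 / 9) * (\<Sum>j<12. (side r j \<bullet> side r k) *
      integral {0..1} (\<lambda>t. integral {0..1} (\<lambda>s. cmod (edge r k t - edge r j s) ^ 3)))"
      by (intro integral_unique has_integral_mult_right has_integral_sum finite_lessThan integrable_integral
          integrable_continuous_interval cJ)
    finally show "(\<integral>y. indicator (dodecagon r) y * integral {0..1} (?h k y) \<partial>lborel) = \<dots>" .
  qed
  finally show ?thesis unfolding sum_distrib_left[symmetric] .
qed

section \<open>Area of the dodecagon and its identification with the regular polygon\<close>

text \<open>Green's formula for the function 1 with primitive \<open>Re\<close>: a sum of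
  trapezoids, one for each side.\<close>

lemma measure_dodecagon:
  assumes r: "r > 0"
  shows "measure lborel (dodecagon r) = 3 * r\<^sup>2"
proof -
  have "measure lborel (dodecagon r) = (\<integral>z. indicator (dodecagon r) z * 1 \<partial>lborel)"
    using closed_dodecagon[of r] by (simp add: borel_closed)
  also have "\<dots> = (\<Sum>k<12. Im (vertex r (Suc k) - vertex r k) * integral {0..1} (\<lambda>t. Re (edge r k t)))"
    by (rule integral_dodecagon_partial_x[OF r]) (auto intro!: continuous_intros derivative_eq_intros)
  finally have area: "measure lborel (dodecagon r) =
    (\<Sum>k<12. Im (vertex r (Suc k) - vertex r k) * integral {0..1} (\<lambda>t. Re (edge r k t)))" .
  have mid: "integral {0..1} (\<lambda>t. Re (edge r k t)) = (Re (vertex r k) + Re (vertex r (Suc k))) / 2" for k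
  proof (rule integral_unique)
    have "((\<lambda>t. Re (edge r k t)) has_integral
       (\<lambda>t. Re (vertex r k) * t + (Re (vertex r (Suc k)) - Re (vertex r k)) * t\<^sup>2 / 2) 1 -
       (\<lambda>t. Re (vertex r k) * t + (Re (vertex r (Suc k)) - Re (vertex r k)) * t\<^sup>2 / 2) 0) {0..1}"
      by (rule fundamental_theorem_of_calculus)
        (auto intro!: derivative_eq_intros simp: has_real_derivative_iff_has_vector_derivative[symmetric] edge_def field_simps)
    then show "((\<lambda>t. Re (edge r k t)) has_integral (Re (vertex r k) + Re (vertex r (Suc k))) / 2) {0..1}"
      by (simp add: field_simps)
  qed
  have S: "Suc 0 = 1" "Suc 1 = 2" "Suc 2 = 3" "Suc 3 = 4" "Suc 4 = 5" "Suc 5 = 6" "Suc 6 = 7" "Suc 7 = 8" "Suc 8 = 9"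
    "Suc 9 = 10" "Suc 10 = 11" "Suc 11 = 12" by simp_all
  show ?thesis
    unfolding area mid sum_lessThan_12 S vertex_values by (simp add: algebra_simps power2_eq_square)
qed

text \<open>Reflections in the axes group the twelve sides into three families of four, and each
  family lies on the boundary of one such rhombus. Convexity of the dodecagon thus needs three sets
  instead of twelve half-planes.\<close>

lemma convex_weighted_l1_ball:
  assumes "\<alpha> \<ge> 0" "\<beta> \<ge> 0"
  shows "convex {z. \<alpha> * \<bar>Re z\<bar> + \<beta> * \<bar>Im z\<bar> \<le> d}"
proof (rule convexI)
  fix z w :: complex and u v :: real
  assume a: "z \<in> {z. \<alpha> * \<bar>Re z\<bar> + \<beta> * \<bar>Im z\<bar> \<le> d}" "w \<in> {z. \<alpha> * \<bar>Re z\<bar> + \<beta> * \<bar>Im z\<bar> \<le> d}"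
    and uv: "0 \<le> u" "0 \<le> v" "u + v = 1"
  have tri: "\<bar>u * x + v * y\<bar> \<le> u * \<bar>x\<bar> + v * \<bar>y\<bar>" for x y :: real
    using abs_triangle_ineq[of "u * x" "v * y"] uv by (simp add: abs_mult)
  have "\<alpha> * \<bar>u * Re z + v * Re w\<bar> + \<beta> * \<bar>u * Im z + v * Im w\<bar>
      \<le> \<alpha> * (u * \<bar>Re z\<bar> + v * \<bar>Re w\<bar>) + \<beta> * (u * \<bar>Im z\<bar> + v * \<bar>Im w\<bar>)"
    by (intro add_mono mult_left_mono tri assms)
  also have "\<dots> = u * (\<alpha> * \<bar>Re z\<bar> + \<beta> * \<bar>Im z\<bar>) + v * (\<alpha> * \<bar>Re w\<bar> + \<beta> * \<bar>Im w\<bar>)"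
    by (simp add: algebra_simps)
  also have "\<dots> \<le> u * d + v * d"
    using a uv by (intro add_mono mult_left_mono) auto
  also have "\<dots> = d" using uv by (simp flip: distrib_right)
  finally show "u *\<^sub>R z + v *\<^sub>R w \<in> {z. \<alpha> * \<bar>Re z\<bar> + \<beta> * \<bar>Im z\<bar> \<le> d}" by simp
qed

lemma dodecagon_eq:
  "dodecagon r = {z. 1 * \<bar>Re z\<bar> + (2 - sqrt 3) * \<bar>Im z\<bar> \<le> r} \<inter> {z. 1 * \<bar>Re z\<bar> + 1 * \<bar>Im z\<bar> \<le> (1 + sqrt 3) / 2 * r}
     \<inter> {z. (2 - sqrt 3) * \<bar>Re z\<bar> + 1 * \<bar>Im z\<bar> \<le> r}"
proof -
  have "z \<in> dodecagon r \<longleftrightarrow> 1 * \<bar>Re z\<bar> + (2 - sqrt 3) * \<bar>Im z\<bar> \<le> r \<and> 1 * \<bar>Re z\<bar> + 1 * \<bar>Im z\<bar> \<le> (1 + sqrt 3) / 2 * r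
      \<and> (2 - sqrt 3) * \<bar>Re z\<bar> + 1 * \<bar>Im z\<bar> \<le> r" for z
    unfolding dodecagon_def half_width_def mem_Collect_eq min.bounded_iff
    using two_minus_sqrt3_le[of "\<bar>Re z\<bar>" "r - \<bar>Im z\<bar>"] by linarith
  then show ?thesis by blast
qed

lemma convex_dodecagon: "convex (dodecagon r)"
  unfolding dodecagon_eq using sqrt3_bounds
  by (intro convex_Int convex_weighted_l1_ball) auto

lemma vertex_in_dodecagon:
  assumes r: "r > 0" and k: "k < 12"
  shows "vertex r k \<in> dodecagon r"
proof -
  have pos: "\<bar>r\<bar> = r" "\<bar>sqrt 3 / 2 * r\<bar> = sqrt 3 / 2 * r" "\<bar>r / 2\<bar> = r / 2"
    "\<bar>- r\<bar> = r" "\<bar>- (sqrt 3 / 2 * r)\<bar> = sqrt 3 / 2 * r" "\<bar>- (r / 2)\<bar> = r / 2" "\<bar>0::real\<bar> = 0"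
    using r by (auto simp: abs_mult)
  have m: "sqrt 3 * r \<le> 1.74 * r" "1.7 * r \<le> sqrt 3 * r"
    using r sqrt3_bounds by (auto intro!: mult_right_mono)
  have e: "(2 - sqrt 3) * r = 2 * r - sqrt 3 * r" "(2 - sqrt 3) * (r / 2) = r - sqrt 3 * r / 2"
     "(2 - sqrt 3) * (sqrt 3 / 2 * r) = sqrt 3 * r - 3 / 2 * r" "(1 + sqrt 3) / 2 * r = r / 2 + sqrt 3 * r / 2"
     "sqrt 3 / 2 * r = sqrt 3 * r / 2"
    by (simp_all add: field_simps)
  have "Complex x y \<in> dodecagon r" if "(\<bar>x\<bar>, \<bar>y\<bar>) \<in> {(r, 0), (sqrt 3 / 2 * r, r / 2), (r / 2, sqrt 3 / 2 * r), (0, r)}" for x y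
    using that m r unfolding dodecagon_eq Int_iff mem_Collect_eq complex.sel insert_iff empty_iff prod.inject
    by (elim disjE conjE; simp only: e; simp add: field_simps)
  note C = this
  have V: "vertex r 0 \<in> dodecagon r" "vertex r 1 \<in> dodecagon r" "vertex r 2 \<in> dodecagon r" "vertex r 3 \<in> dodecagon r"
    "vertex r 4 \<in> dodecagon r" "vertex r 5 \<in> dodecagon r" "vertex r 6 \<in> dodecagon r" "vertex r 7 \<in> dodecagon r"
    "vertex r 8 \<in> dodecagon r" "vertex r 9 \<in> dodecagon r" "vertex r 10 \<in> dodecagon r" "vertex r 11 \<in> dodecagon r"
    unfolding vertex_values by (rule C, unfold pos, blast)+
  have "k = 0 \<or> k = 1 \<or> k = 2 \<or> k = 3 \<or> k = 4 \<or> k = 5 \<or> k = 6 \<or> k = 7 \<or> k = 8 \<or> k = 9 \<or> k = 10 \<or> k = 11"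
    using k by (simp add: eval_nat_numeral less_Suc_eq)
  then show ?thesis using V by metis
qed

text \<open>Two convex combinations reach the point: one along each slanted side up to height
  \<open>y\<close>, giving the abscissas \<open>X\<close> and \<open>- X\<close>, and one along the
  chord between them.\<close>

lemma trapezoid_subset:
  assumes S: "convex S" and y: "y1 < y2" "y1 \<le> y" "y \<le> y2"
    and v: "Complex x1 y1 \<in> S" "Complex (- x1) y1 \<in> S" "Complex x2 y2 \<in> S" "Complex (- x2) y2 \<in> S"
    and x: "(y2 - y1) * \<bar>x\<bar> \<le> (y2 - y) * x1 + (y - y1) * x2"
  shows "Complex x y \<in> S"
proof -
  define l where "l = (y - y1) / (y2 - y1)"
  define X where "X = (1 - l) * x1 + l * x2"
  have l: "0 \<le> l" "l \<le> 1" using y by (auto simp: l_def)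
  have ly: "l * (y2 - y1) = y - y1" using y by (simp add: l_def)
  have yl: "y = (1 - l) * y1 + l * y2" using ly by (simp add: algebra_simps)
  have "(y2 - y1) * X = (y2 - y1 - l * (y2 - y1)) * x1 + (l * (y2 - y1)) * x2"
    by (simp add: X_def algebra_simps)
  then have "(y2 - y1) * X = (y2 - y) * x1 + (y - y1) * x2"
    unfolding ly by simp
  then have xX: "\<bar>x\<bar> \<le> X" using x y by (metis diff_gt_0_iff_gt mult_le_cancel_left_pos)
  have "Complex X y = (1 - l) *\<^sub>R Complex x1 y1 + l *\<^sub>R Complex x2 y2"
    "Complex (- X) y = (1 - l) *\<^sub>R Complex (- x1) y1 + l *\<^sub>R Complex (- x2) y2"
    using yl by (auto intro!: complex_eqI simp: X_def algebra_simps)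
  then have P: "Complex X y \<in> S" "Complex (- X) y \<in> S"
    using convexD_alt[OF S v(1,3) l] convexD_alt[OF S v(2,4) l] by simp_all
  show ?thesis
  \<comment> \<open>At a tip, where the trapezoid is a triangle, the chord shrinks to a point and
    the quotient \<open>m\<close> has no meaning.\<close>
  proof (cases "X = 0")
    case True then show ?thesis using P xX by simp
  next
    case False
    then have X: "X > 0" using xX by linarith
    define m where "m = (x + X) / (2 * X)"
    have m: "0 \<le> m" "m \<le> 1" using X xX by (auto simp: m_def)
    have "x = (1 - m) * (- X) + m * X" using X by (simp add: m_def field_simps)
    then have "Complex x y = (1 - m) *\<^sub>R Complex (- X) y + m *\<^sub>R Complex X y"
      by (auto intro!: complex_eqI simp: algebra_simps)
    then show ?thesis using convexD_alt[OF S P(2,1) m] by simp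
  qed
qed

text \<open>One inclusion is minimality of the hull. For the other, the dodecagon is cut at the
  heights of its vertices into six slabs, each a trapezoid (a triangle at the top and the bottom)
  spanned by vertices.\<close>

lemma regular_polygon_12:
  assumes r: "r > 0"
  shows "regular_polygon 12 r = dodecagon r"
proof -
  let ?S = "convex hull (vertex r ` {..<12})"
  have "regular_polygon 12 r = ?S"
    unfolding regular_polygon_def vertex_def
    by (rule arg_cong[where f = "\<lambda>S. convex hull S"], rule image_cong) (simp_all add: field_simps)
  also have "?S = dodecagon r"
  proof (rule antisym)
    show "?S \<subseteq> dodecagon r"
      by (rule hull_minimal) (use vertex_in_dodecagon[OF r] convex_dodecagon in auto)
    have S: "convex ?S" by (rule convex_convex_hull)
    have V: "vertex r 0 \<in> ?S" "vertex r 1 \<in> ?S" "vertex r 2 \<in> ?S" "vertex r 3 \<in> ?S" "vertex r 4 \<in> ?S" "vertex r 5 \<in> ?S"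
      "vertex r 6 \<in> ?S" "vertex r 7 \<in> ?S" "vertex r 8 \<in> ?S" "vertex r 9 \<in> ?S" "vertex r 10 \<in> ?S" "vertex r 11 \<in> ?S"
      by (rule hull_inc, simp)+
    note V = V[unfolded vertex_values]
    have r1: "r / 2 < sqrt 3 / 2 * r"
      using mult_strict_right_mono[of "1/2" "sqrt 3 / 2" r] sqrt3_bounds r by simp
    have r2: "sqrt 3 / 2 * r < r"
      using mult_strict_right_mono[of "sqrt 3 / 2" 1 r] sqrt3_bounds r by simp
    have mono: "d * x \<le> w" if "x \<le> h" "0 < d" "d * h = w" for d x h w :: real
      using mult_left_mono[of x h d] that by simp
    show "dodecagon r \<subseteq> ?S"
    proof
      fix z assume "z \<in> dodecagon r"
      then obtain x y where z: "z = Complex x y" and x: "\<bar>x\<bar> \<le> half_width r y"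
        by (cases z) (auto simp: dodecagon_def)
      have y: "\<bar>y\<bar> \<le> r" using x by (intro half_width_nonneg) linarith
      note hw = half_width_cases[OF less_imp_le[OF r], of y]
      consider "y \<le> - (sqrt 3 / 2 * r)" | "- (sqrt 3 / 2 * r) \<le> y" "y \<le> - (r / 2)" | "- (r / 2) \<le> y" "y \<le> 0"
        | "0 \<le> y" "y \<le> r / 2" | "r / 2 \<le> y" "y \<le> sqrt 3 / 2 * r" | "sqrt 3 / 2 * r \<le> y"
        by linarith
      then show "z \<in> ?S"
      proof cases
        case 1
        then have h: "half_width r y = (2 + sqrt 3) * (r + y)" using hw(3) r1 r by simp
        have "((- (sqrt 3 / 2 * r)) - (- r)) * \<bar>x\<bar> \<le> ((- (sqrt 3 / 2 * r)) - y) * (0) + (y - (- r)) * (r / 2)"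
          by (rule mono[OF x], use r r1 r2 in simp, unfold h, simp add: field_simps)
        then show ?thesis unfolding z
          by (intro trapezoid_subset[OF S, of "(- r)" "(- (sqrt 3 / 2 * r))" y "(0)" "(r / 2)"])
            (use V y r r1 r2 1 in simp_all)
      next
        case 2
        then have h: "half_width r y = (1 + sqrt 3) / 2 * r + y" using hw(2) r1 r by simp
        have "((- (r / 2)) - (- (sqrt 3 / 2 * r))) * \<bar>x\<bar> \<le> ((- (r / 2)) - y) * (r / 2) + (y - (- (sqrt 3 / 2 * r))) * (sqrt 3 / 2 * r)"
          by (rule mono[OF x], use r r1 r2 in simp, unfold h, simp add: field_simps)
        then show ?thesis unfolding z
          by (intro trapezoid_subset[OF S, of "(- (sqrt 3 / 2 * r))" "(- (r / 2))" y "(r / 2)" "(sqrt 3 / 2 * r)"])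
            (use V y r r1 r2 2 in simp_all)
      next
        case 3
        then have h: "half_width r y = r + (2 - sqrt 3) * y" using hw(1) r1 r by simp
        have "((0) - (- (r / 2))) * \<bar>x\<bar> \<le> ((0) - y) * (sqrt 3 / 2 * r) + (y - (- (r / 2))) * (r)"
          by (rule mono[OF x], use r r1 r2 in simp, unfold h, simp add: field_simps)
        then show ?thesis unfolding z
          by (intro trapezoid_subset[OF S, of "(- (r / 2))" "(0)" y "(sqrt 3 / 2 * r)" "(r)"])
            (use V y r r1 r2 3 in simp_all)
      next
        case 4
        then have h: "half_width r y = r - (2 - sqrt 3) * y" using hw(1) r1 r by simp
        have "((r / 2) - (0)) * \<bar>x\<bar> \<le> ((r / 2) - y) * (r) + (y - (0)) * (sqrt 3 / 2 * r)"
          by (rule mono[OF x], use r r1 r2 in simp, unfold h, simp add: field_simps)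
        then show ?thesis unfolding z
          by (intro trapezoid_subset[OF S, of "(0)" "(r / 2)" y "(r)" "(sqrt 3 / 2 * r)"])
            (use V y r r1 r2 4 in simp_all)
      next
        case 5
        then have h: "half_width r y = (1 + sqrt 3) / 2 * r - y" using hw(2) r1 r by simp
        have "((sqrt 3 / 2 * r) - (r / 2)) * \<bar>x\<bar> \<le> ((sqrt 3 / 2 * r) - y) * (sqrt 3 / 2 * r) + (y - (r / 2)) * (r / 2)"
          by (rule mono[OF x], use r r1 r2 in simp, unfold h, simp add: field_simps)
        then show ?thesis unfolding z
          by (intro trapezoid_subset[OF S, of "(r / 2)" "(sqrt 3 / 2 * r)" y "(sqrt 3 / 2 * r)" "(r / 2)"])
            (use V y r r1 r2 5 in simp_all)
      next
        case 6
        then have h: "half_width r y = (2 + sqrt 3) * (r - y)" using hw(3) r1 r by simp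
        have "((r) - (sqrt 3 / 2 * r)) * \<bar>x\<bar> \<le> ((r) - y) * (r / 2) + (y - (sqrt 3 / 2 * r)) * (0)"
          by (rule mono[OF x], use r r1 r2 in simp, unfold h, simp add: field_simps)
        then show ?thesis unfolding z
          by (intro trapezoid_subset[OF S, of "(sqrt 3 / 2 * r)" "(r)" y "(r / 2)" "(0)"])
            (use V y r r1 r2 6 in simp_all)
      qed
    qed
  qed
  finally show ?thesis .
qed

section \<open>The mean distance as a double integral\<close>

text \<open>Each uniform measure is a density with respect to Lebesgue measure, hence so is their
  product; the two normalising constants give the squared measure in the denominator.\<close>

lemma mean_distance_compact:
  fixes K :: "'a::euclidean_space set"
  assumes K: "compact K" and pos: "measure lborel K > 0"
  shows "mean_distance K =
    (\<integral>x. indicator K x * (\<integral>y. indicator K y * dist y x \<partial>lborel) \<partial>lborel) / (measure lborel K)\<^sup>2"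
proof -
  let ?A = "measure lborel K"
  let ?U = "uniform_measure lborel K"
  have [measurable]: "K \<in> sets borel" using K by (simp add: borel_compact)
  have fin: "emeasure lborel K < \<infinity>" using emeasure_compact_finite[OF K] by simp
  then have em: "emeasure lborel K = ennreal ?A" by (simp add: emeasure_eq_ennreal_measure)
  have dens: "?U = density lborel (\<lambda>x. ennreal (indicator K x / ?A))"
    unfolding uniform_measure_def em
  proof (rule density_cong)
    show "AE x in lborel. indicator K x / ennreal ?A = ennreal (indicator K x / ?A)"
      using divide_ennreal[of 1 ?A] pos by (auto simp: indicator_def)
  qed auto
  have "emeasure ?U (space ?U) = 1"
    using pos by (simp add: em ennreal_divide_self)
  then have "finite_measure ?U" by (intro finite_measureI) simp
  then have sf: "sigma_finite_measure (density lborel (\<lambda>x. ennreal (indicator K x / ?A)))"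
    unfolding dens by (rule finite_measure.axioms(1))
  have P: "?U \<Otimes>\<^sub>M ?U = density (lborel \<Otimes>\<^sub>M lborel) (\<lambda>p. ennreal ((indicator K (fst p) / ?A) * (indicator K (snd p) / ?A)))"
  proof -
    have "?U \<Otimes>\<^sub>M ?U = density (lborel \<Otimes>\<^sub>M lborel) (\<lambda>(x, y). ennreal (indicator K x / ?A) * ennreal (indicator K y / ?A))"
      unfolding dens by (rule pair_measure_density) (auto intro: sf sigma_finite_lborel)
    also have "\<dots> = density (lborel \<Otimes>\<^sub>M lborel) (\<lambda>p. ennreal ((indicator K (fst p) / ?A) * (indicator K (snd p) / ?A)))"
      by (rule density_cong) (auto simp: ennreal_mult[symmetric] pos[THEN less_imp_le])
    finally show ?thesis .
  qed
  let ?h = "\<lambda>x y. indicator K x * (indicator K y * dist y x)"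
  have int: "integrable (lborel \<Otimes>\<^sub>M lborel) (case_prod ?h)"
  proof -
    have "integrable lborel (\<lambda>p. indicator (K \<times> K) p *\<^sub>R dist (snd p) (fst p))"
      by (rule borel_integrable_compact[OF compact_Times[OF K K]]) (intro continuous_intros)
    then show ?thesis
      unfolding lborel_prod by (simp add: case_prod_beta' indicator_times mult.assoc)
  qed
  have "mean_distance K = (\<integral>p. ((indicator K (fst p) / ?A) * (indicator K (snd p) / ?A)) *\<^sub>R dist (fst p) (snd p) \<partial>(lborel \<Otimes>\<^sub>M lborel))"
    unfolding mean_distance_def P by (rule integral_density) (auto simp: pos[THEN less_imp_le])
  also have "\<dots> = (\<integral>p. case_prod ?h p / ?A\<^sup>2 \<partial>(lborel \<Otimes>\<^sub>M lborel))"
    by (rule Bochner_Integration.integral_cong) (auto simp: power2_eq_square dist_commute case_prod_beta')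
  also have "\<dots> = (\<integral>p. case_prod ?h p \<partial>(lborel \<Otimes>\<^sub>M lborel)) / ?A\<^sup>2"
    by simp
  also have "(\<integral>p. case_prod ?h p \<partial>(lborel \<Otimes>\<^sub>M lborel)) = (\<integral>x. (\<integral>y. ?h x y \<partial>lborel) \<partial>lborel)"
    using lborel_pair.integral_fst[OF int] by simp
  also have "\<dots> = (\<integral>x. indicator K x * (\<integral>y. indicator K y * dist y x \<partial>lborel) \<partial>lborel)"
    by simp
  finally show ?thesis .
qed

subsection \<open>Cubed distance between two segments\<close>

text \<open>The third side of a triangle whose sides \<open>u\<close>, \<open>v\<close> enclose an angle with cosine \<open>c\<close>.\<close>
definition third_side :: "real \<Rightarrow> real \<Rightarrow> real \<Rightarrow> real" where
  "third_side c u v = sqrt (u\<^sup>2 + v\<^sup>2 - 2 * u * v * c)"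

text \<open>A primitive of \<open>third_side c u v ^ 3\<close> in \<open>v\<close>. The constant of integration, that is the division by \<open>u\<close>
  under the logarithm, is chosen to make it homogeneous of degree 4 in \<open>(u, v)\<close>.\<close>
definition cube_prim :: "real \<Rightarrow> real \<Rightarrow> real \<Rightarrow> real" where
  "cube_prim c u v = (v - u * c) * third_side c u v ^ 3 / 4 + 3 / 8 * (u\<^sup>2 * (1 - c\<^sup>2)) * (v - u * c) * third_side c u v
     + 3 / 8 * (u\<^sup>2 * (1 - c\<^sup>2))\<^sup>2 * ln ((v - u * c + third_side c u v) / u)"

text \<open>Completing the square gives \<open>(v - u * c)^2 + u^2 * (1 - c^2)\<close>. Here
  \<open>v - u * c\<close> is the offset along the second line from the foot of the perpendicular
  dropped from the point at distance \<open>u\<close> on the first, and the other summand is the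
  squared height. The positive height keeps square root and logarithm differentiable.\<close>

lemma third_side_pos:
  assumes "\<bar>c\<bar> < 1" "u > 0"
  shows "u\<^sup>2 + v\<^sup>2 - 2 * u * v * c > 0" "third_side c u v > 0" "(third_side c u v)\<^sup>2 = u\<^sup>2 + v\<^sup>2 - 2 * u * v * c"
    "v - u * c + third_side c u v > 0"
proof -
  have c: "1 - c\<^sup>2 > 0" using assms(1) by (simp add: abs_square_less_1)
  have e: "u\<^sup>2 + v\<^sup>2 - 2 * u * v * c = (v - u * c)\<^sup>2 + u\<^sup>2 * (1 - c\<^sup>2)"
    by (simp add: power2_eq_square algebra_simps)
  have p: "u\<^sup>2 * (1 - c\<^sup>2) > 0" using c assms(2) by simp
  show q: "u\<^sup>2 + v\<^sup>2 - 2 * u * v * c > 0"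
    unfolding e using p by (simp add: add_nonneg_pos)
  then show "third_side c u v > 0" "(third_side c u v)\<^sup>2 = u\<^sup>2 + v\<^sup>2 - 2 * u * v * c"
    by (simp_all add: third_side_def)
  have "sqrt ((v - u * c)\<^sup>2) < third_side c u v"
    unfolding third_side_def e by (rule real_sqrt_less_mono) (use p in linarith)
  then have "\<bar>v - u * c\<bar> < third_side c u v" by simp
  then show "v - u * c + third_side c u v > 0" by linarith
qed

lemma third_side_commute: "third_side c u v = third_side c v u"
  unfolding third_side_def by (simp add: algebra_simps)

lemma deriv_third_side:
  assumes "\<bar>c\<bar> < 1" "u > 0"
  shows "((\<lambda>v. third_side c u v) has_real_derivative (v - u * c) / third_side c u v) (at v)"
    "((\<lambda>u. third_side c u v) has_real_derivative (u - v * c) / third_side c u v) (at u)"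
proof -
  note p = third_side_pos[OF assms, of v]
  have "((\<lambda>v. u\<^sup>2 + v\<^sup>2 - 2 * u * v * c) has_real_derivative 2 * (v - u * c)) (at v)"
    "((\<lambda>u. u\<^sup>2 + v\<^sup>2 - 2 * u * v * c) has_real_derivative 2 * (u - v * c)) (at u)"
    by (auto intro!: derivative_eq_intros simp: algebra_simps)
  note d = this
  have alg: "inverse s / 2 * (2 * w) = w / s" for s w :: real
    by (cases "s = 0") (simp_all add: field_simps)
  from DERIV_chain2[where f = sqrt and g = "\<lambda>v. u\<^sup>2 + v\<^sup>2 - 2 * u * v * c", OF DERIV_real_sqrt[OF p(1)] d(1)]
  show "((\<lambda>v. third_side c u v) has_real_derivative (v - u * c) / third_side c u v) (at v)"
    unfolding third_side_def alg .
  from DERIV_chain2[where f = sqrt and g = "\<lambda>u. u\<^sup>2 + v\<^sup>2 - 2 * u * v * c", OF DERIV_real_sqrt[OF p(1)] d(2)]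
  show "((\<lambda>u. third_side c u v) has_real_derivative (u - v * c) / third_side c u v) (at u)"
    unfolding third_side_def alg .
qed

text \<open>In \<open>v\<close> the logarithm is \<open>arsinh\<close> of offset over height, up to
  a constant. Dividing by \<open>u\<close> makes it homogeneous of degree 0, so by Euler's identity
  \<open>u\<close> times the \<open>u\<close>-derivative is minus \<open>v\<close> times the
  \<open>v\<close>-derivative, which explains the second formula.\<close>

lemma deriv_ln_third_side:
  assumes "\<bar>c\<bar> < 1" "u > 0"
  shows "((\<lambda>v. ln ((v - u * c + third_side c u v) / u)) has_real_derivative 1 / third_side c u v) (at v)"
    "((\<lambda>u. ln ((v - u * c + third_side c u v) / u)) has_real_derivative - v / (u * third_side c u v)) (at u)"
proof -
  note p = third_side_pos[OF assms, of v]
  let ?D = "third_side c u v"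
  have nz: "(v - u * c + ?D) / u > 0" using p(4) assms(2) by simp
  have "((\<lambda>v. ln ((v - u * c + third_side c u v) / u)) has_real_derivative
     (1 + (v - u * c) / ?D) / u / ((v - u * c + ?D) / u)) (at v)"
    using nz assms(2) by (auto intro!: derivative_eq_intros deriv_third_side(1)[OF assms])
  also have "(1 + (v - u * c) / ?D) / u / ((v - u * c + ?D) / u) = 1 / ?D"
    using p(2,4) assms(2) by (simp add: divide_simps)
  finally show "((\<lambda>v. ln ((v - u * c + third_side c u v) / u)) has_real_derivative 1 / third_side c u v) (at v)" .
  have "((\<lambda>u. ln ((v - u * c + third_side c u v) / u)) has_real_derivative
     ((- c + (u - v * c) / ?D) * u - (v - u * c + ?D)) / (u * u) / ((v - u * c + ?D) / u)) (at u)"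
    using nz assms(2) by (auto intro!: derivative_eq_intros deriv_third_side(2)[OF assms])
  also have "((- c + (u - v * c) / ?D) * u - (v - u * c + ?D)) / (u * u) / ((v - u * c + ?D) / u) = - v / (u * ?D)"
  proof -
    have "?D * ((- c + (u - v * c) / ?D) * u - (v - u * c + ?D)) = (- c * ?D + (u - v * c)) * u - (v - u * c) * ?D - ?D\<^sup>2"
      using p(2) by (simp add: field_simps power2_eq_square)
    also have "\<dots> = - v * (v - u * c + ?D)"
      unfolding p(3) by (simp add: algebra_simps power2_eq_square)
    finally have "?D * ((- c + (u - v * c) / ?D) * u - (v - u * c + ?D)) = - v * (v - u * c + ?D)" .
    moreover have "x = y / d" if "d * x = y" "d > 0" for x y d :: real
      using that by auto
    ultimately have k: "(- c + (u - v * c) / ?D) * u - (v - u * c + ?D) = - v * (v - u * c + ?D) / ?D"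
      using p(2) by blast
    show ?thesis unfolding k using p(2,4) assms(2) by (simp add: divide_simps)
  qed
  finally show "((\<lambda>u. ln ((v - u * c + third_side c u v) / u)) has_real_derivative - v / (u * third_side c u v)) (at u)" .
qed

lemma deriv_cube_prim_aux:
  assumes "(z has_real_derivative z') (at x)" "(D has_real_derivative D') (at x)"
    "(p has_real_derivative p') (at x)" "(l has_real_derivative l') (at x)"
  shows "((\<lambda>x. z x * D x ^ 3 / 4 + 3 / 8 * p x * z x * D x + 3 / 8 * (p x)\<^sup>2 * l x) has_real_derivative
    (z' * D x ^ 3 + z x * (3 * (D x)\<^sup>2 * D')) / 4
     + (3 / 8 * p' * (z x * D x) + 3 / 8 * p x * (z' * D x + z x * D'))
     + (3 / 8 * (2 * p x * p') * l x + 3 / 8 * (p x)\<^sup>2 * l')) (at x)"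
  by (auto intro!: derivative_eq_intros assms simp: field_simps)

text \<open>Everything follows from \<open>z * z + p = D * D\<close> and the linear relations
  between \<open>u\<close>, \<open>v\<close>, \<open>w\<close> and \<open>z\<close>. The letters
  stand for \<open>z = v - u * c\<close>, \<open>w = u - v * c\<close>, the squared height
  \<open>p\<close> and the logarithm \<open>l\<close>. The first equation belongs to the
  \<open>v\<close>-derivative; the second, multiplied through by \<open>u\<close>, is Euler's
  identity for degree 4.\<close>

lemma cube_prim_key:
  fixes D z p v l :: real
  assumes D: "D > 0" and p: "p = D\<^sup>2 - z\<^sup>2"
  shows "(1 * D ^ 3 + z * (3 * D\<^sup>2 * (z / D))) / 4 + (3 / 8 * 0 * (z * D) + 3 / 8 * p * (1 * D + z * (z / D)))
     + (3 / 8 * (2 * p * 0) * l + 3 / 8 * p\<^sup>2 * (1 / D)) = D ^ 3"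
    and "u > 0 \<Longrightarrow> u * w = D\<^sup>2 - v * z \<Longrightarrow> c * u = v - z \<Longrightarrow> p' * u = 2 * p \<Longrightarrow>
     ((- c * D ^ 3 + z * (3 * D\<^sup>2 * (w / D))) / 4 + (3 / 8 * p' * (z * D) + 3 / 8 * p * (- c * D + z * (w / D)))
     + (3 / 8 * (2 * p * p') * l + 3 / 8 * p\<^sup>2 * (- v / (u * D)))) * u
     = 4 * (z * D ^ 3 / 4 + 3 / 8 * p * z * D + 3 / 8 * p\<^sup>2 * l) - v * D ^ 3"
proof -
  have zp: "z * z + p = D * D" unfolding p by (simp add: power2_eq_square)
  have "p * (z * (z / D)) + p\<^sup>2 * (1 / D) = p * ((z * z + p) / D)"
    by (simp add: power2_eq_square distrib_left add_divide_distrib)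
  also have "\<dots> = p * D" unfolding zp using D by simp
  finally have pD: "p\<^sup>2 * (1 / D) = p * D - p * (z * (z / D))" by linarith
  have DD: "D\<^sup>2 * (z / D) = D * z" using D by (simp add: power2_eq_square)
  have zD: "D ^ 3 = z * (D * z) + p * D"
    using arg_cong[OF zp, of "\<lambda>x. x * D"] by (simp add: algebra_simps power3_eq_cube)
  have "(1 * a + z * (3 * b * x)) / 4 + (3 / 8 * 0 * (z * D) + 3 / 8 * p * (1 * D + z * x))
     + (3 / 8 * (2 * p * 0) * l + 3 / 8 * e * y) = a"
    if "b * x = D * z" "e * y = p * D - p * (z * x)" "a = z * (D * z) + p * D" for a b e x y
  proof -
    have 1: "z * (3 * b * x) = 3 * z * (D * z)"
      unfolding that(1)[symmetric] by simp
    have 2: "3 / 8 * e * y = 3 / 8 * (p * D - p * (z * x))"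
      unfolding that(2)[symmetric] by simp
    show ?thesis unfolding 1 2 that(3) by (simp add: field_simps)
  qed
  from this[OF DD pD zD]
  show "(1 * D ^ 3 + z * (3 * D\<^sup>2 * (z / D))) / 4 + (3 / 8 * 0 * (z * D) + 3 / 8 * p * (1 * D + z * (z / D)))
     + (3 / 8 * (2 * p * 0) * l + 3 / 8 * p\<^sup>2 * (1 / D)) = D ^ 3" .
  assume u: "u > 0" and uw: "u * w = D\<^sup>2 - v * z" and cu: "c * u = v - z" and pu: "p' * u = 2 * p"
  have wD: "(w / D) * u = D - v * (z / D)"
  proof -
    have "(w / D) * u = (u * w) / D" by simp
    also have "\<dots> = D - v * (z / D)"
      unfolding uw using D by (simp add: diff_divide_distrib power2_eq_square)
    finally show ?thesis .
  qed
  have vD: "(- v / (u * D)) * u = - (v * (1 / D))" using u by simp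
  \<comment> \<open>Quotients and powers become letters too, known only through the equations they
    satisfy. After multiplication by \<open>u\<close> only polynomial rewriting remains.\<close>
  have gen: "((- c * a + z * (3 * b * X)) / 4 + (3 / 8 * p' * (z * D) + 3 / 8 * p * (- c * D + z * X))
     + (3 / 8 * (2 * p * p') * l + 3 / 8 * e * Q)) * u
     = 4 * (z * a / 4 + 3 / 8 * p * z * D + 3 / 8 * e * l) - v * a"
    if X: "X * u = D - v * x" and Q: "Q * u = - (v * y)" and b: "b * x = D * z" "b * D = a"
      and ey: "e * y = p * D - p * (z * x)" and e: "e = p * p" and a: "a = z * (D * z) + p * D" for a b e x y X Q
  proof -
    have bX: "b * (D - v * x) = a - v * (D * z)"
      unfolding right_diff_distrib b(2) mult.left_commute[of b v] b(1) ..
    have eQ: "e * (Q * u) = - (v * (p * D - p * (z * x)))"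
      unfolding Q mult_minus_right mult.left_commute[of e v] ey ..
    have "((- c * a + z * (3 * b * X)) / 4 + (3 / 8 * p' * (z * D) + 3 / 8 * p * (- c * D + z * X))
      + (3 / 8 * (2 * p * p') * l + 3 / 8 * e * Q)) * u
      = (- (c * u) * a + 3 * z * (b * (X * u))) / 4 + 3 / 8 * (p' * u) * (z * D) + 3 / 8 * p * (- (c * u) * D + z * (X * u))
        + 3 / 8 * (2 * p * (p' * u)) * l + 3 / 8 * (e * (Q * u))"
      by (simp add: algebra_simps)
    also have "\<dots> = (- (v - z) * a + 3 * z * (a - v * (D * z))) / 4 + 3 / 8 * (2 * p) * (z * D) + 3 / 8 * p * (- (v - z) * D + z * (D - v * x))
        + 3 / 8 * (2 * p * (2 * p)) * l + 3 / 8 * (- (v * (p * D - p * (z * x))))"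
      unfolding X bX eQ cu pu ..
    also have "\<dots> = 4 * (z * a / 4 + 3 / 8 * p * z * D + 3 / 8 * e * l) - v * a"
      unfolding a e by (simp add: field_simps)
    finally show ?thesis .
  qed
  have "D\<^sup>2 * D = D ^ 3" by (simp add: power2_eq_square power3_eq_cube)
  from gen[OF wD vD DD this pD power2_eq_square zD]
  show "((- c * D ^ 3 + z * (3 * D\<^sup>2 * (w / D))) / 4 + (3 / 8 * p' * (z * D) + 3 / 8 * p * (- c * D + z * (w / D)))
     + (3 / 8 * (2 * p * p') * l + 3 / 8 * p\<^sup>2 * (- v / (u * D)))) * u
     = 4 * (z * D ^ 3 / 4 + 3 / 8 * p * z * D + 3 / 8 * p\<^sup>2 * l) - v * D ^ 3" .
qed

lemma deriv_cube_prim: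
  assumes "\<bar>c\<bar> < 1" "u > 0"
  shows "((\<lambda>v. cube_prim c u v) has_real_derivative third_side c u v ^ 3) (at v)"
    "((\<lambda>u. cube_prim c u v) has_real_derivative (4 * cube_prim c u v - v * third_side c u v ^ 3) / u) (at u)"
proof -
  note p = third_side_pos[OF assms, of v]
  let ?D = "third_side c u v" and ?l = "ln ((v - u * c + third_side c u v) / u)"
  have pz: "u\<^sup>2 * (1 - c\<^sup>2) = ?D\<^sup>2 - (v - u * c)\<^sup>2"
    unfolding p(3) by (simp add: power2_eq_square algebra_simps)
  have "((\<lambda>v. cube_prim c u v) has_real_derivative
     (1 * ?D ^ 3 + (v - u * c) * (3 * ?D\<^sup>2 * ((v - u * c) / ?D))) / 4
     + (3 / 8 * 0 * ((v - u * c) * ?D) + 3 / 8 * (u\<^sup>2 * (1 - c\<^sup>2)) * (1 * ?D + (v - u * c) * ((v - u * c) / ?D)))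
     + (3 / 8 * (2 * (u\<^sup>2 * (1 - c\<^sup>2)) * 0) * ?l + 3 / 8 * (u\<^sup>2 * (1 - c\<^sup>2))\<^sup>2 * (1 / ?D))) (at v)" (is "(_ has_real_derivative ?d) _")
    unfolding cube_prim_def
    by (rule deriv_cube_prim_aux[OF _ deriv_third_side(1)[OF assms] _ deriv_ln_third_side(1)[OF assms]])
      (auto intro!: derivative_eq_intros)
  also have "?d = ?D ^ 3"
    by (rule cube_prim_key(1)[OF p(2) pz])
  finally show "((\<lambda>v. cube_prim c u v) has_real_derivative third_side c u v ^ 3) (at v)" .
  have "((\<lambda>u. cube_prim c u v) has_real_derivative
     (- c * ?D ^ 3 + (v - u * c) * (3 * ?D\<^sup>2 * ((u - v * c) / ?D))) / 4
     + (3 / 8 * (2 * u * (1 - c\<^sup>2)) * ((v - u * c) * ?D) + 3 / 8 * (u\<^sup>2 * (1 - c\<^sup>2)) * (- c * ?D + (v - u * c) * ((u - v * c) / ?D)))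
     + (3 / 8 * (2 * (u\<^sup>2 * (1 - c\<^sup>2)) * (2 * u * (1 - c\<^sup>2))) * ?l + 3 / 8 * (u\<^sup>2 * (1 - c\<^sup>2))\<^sup>2 * (- v / (u * ?D)))) (at u)" (is "(_ has_real_derivative ?e) _")
    unfolding cube_prim_def
    by (rule deriv_cube_prim_aux[OF _ deriv_third_side(2)[OF assms] _ deriv_ln_third_side(2)[OF assms]])
      (auto intro!: derivative_eq_intros)
  also have "?e = (4 * cube_prim c u v - v * ?D ^ 3) / u"
  proof -
    have "?e * u = 4 * cube_prim c u v - v * ?D ^ 3"
      unfolding cube_prim_def
      by (rule cube_prim_key(2)[OF p(2) pz assms(2)]) (unfold p(3), simp_all add: power2_eq_square algebra_simps)
    then show ?thesis using assms(2) by (simp add: eq_divide_eq)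
  qed
  finally show "((\<lambda>u. cube_prim c u v) has_real_derivative (4 * cube_prim c u v - v * third_side c u v ^ 3) / u) (at u)" .
qed

text \<open>By Euler's identity for homogeneous functions this is a double primitive of \<open>third_side c u v ^ 3\<close>.\<close>
definition cube_prim2 :: "real \<Rightarrow> real \<Rightarrow> real \<Rightarrow> real" where
  "cube_prim2 c u v = (u * cube_prim c u v + v * cube_prim c v u) / 5"

text \<open>By Euler's identity for degree 4, \<open>u * cube_prim c u v\<close> has the derivative
  \<open>5 * cube_prim c u v - v * third_side c u v ^ 3\<close>. The mirrored summand contributes
  the missing cube, and the factor 5 cancels.\<close>

lemma deriv_cube_prim2:
  assumes c: "\<bar>c\<bar> < 1" and u: "u > 0" and v: "v \<ge> 0"
  shows "((\<lambda>u. cube_prim2 c u v) has_real_derivative cube_prim c u v) (at u)"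
proof -
  have "((\<lambda>u. v * cube_prim c v u) has_real_derivative v * third_side c u v ^ 3) (at u)"
  \<comment> \<open>For \<open>v = 0\<close> the derivative of \<open>cube_prim c v\<close> is not
    at hand, but the factor \<open>v\<close> makes the whole term constant.\<close>
  proof (cases "v = 0")
    case False
    then show ?thesis
      using DERIV_cmult[OF deriv_cube_prim(1)[OF c, of v u], of v] v by (simp add: third_side_commute[of c v u])
  qed simp
  from DERIV_cdivide[OF DERIV_add[OF DERIV_mult[OF DERIV_ident deriv_cube_prim(2)[OF c u, of v]] this], of 5]
  have "((\<lambda>u. cube_prim2 c u v) has_real_derivative
     (1 * cube_prim c u v + (4 * cube_prim c u v - v * third_side c u v ^ 3) / u * u + v * third_side c u v ^ 3) / 5) (at u)"
    unfolding cube_prim2_def .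
  then show ?thesis using u by simp
qed

lemma continuous_power_ln: "continuous_on {0..} (\<lambda>u::real. u ^ 5 * ln u)"
proof -
  have "continuous (at u within {0..}) (\<lambda>u::real. u ^ 5 * ln u)" if "u \<ge> 0" for u
  proof (cases "u = 0")
    case False
    then show ?thesis by (intro continuous_intros) auto
  next
    case True
    have "((\<lambda>u::real. u ^ 5 * ln u) \<longlongrightarrow> 0) (at_right 0)" by real_asymp
    then show ?thesis using True by (simp add: continuous_within at_within_Ici_at_right)
  qed
  then show ?thesis by (simp add: continuous_on_eq_continuous_within)
qed

text \<open>For adjacent sides the integration starts at \<open>u = 0\<close>, where the logarithm
  of the quotient by \<open>u\<close> is singular. Its coefficient in the double primitive is a
  multiple of \<open>u ^ 5\<close>, and \<open>u ^ 5 * ln u\<close> is continuous there.\<close>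

lemma continuous_cube_prim2:
  assumes c: "\<bar>c\<bar> < 1" and v: "v \<ge> 0"
  shows "continuous_on {0..} (\<lambda>u. cube_prim2 c u v)"
proof (cases "v = 0")
  case True
  \<comment> \<open>By homogeneity the function is a multiple of \<open>u ^ 5\<close>; the constant
    \<open>?k\<close> is \<open>cube_prim c 1 0\<close>.\<close>
  let ?k = "- c / 4 - 3 / 8 * (1 - c\<^sup>2) * c + 3 / 8 * (1 - c\<^sup>2)\<^sup>2 * ln (1 - c)"
  have "cube_prim2 c u v = ?k * u ^ 5 / 5" if "u \<in> {0..}" for u
  proof (cases "u = 0")
    case False
    then have u: "u > 0" using that by simp
    have D: "third_side c u 0 = u" using u by (simp add: third_side_def)
    have l: "(0 - u * c + u) / u = 1 - c" using u by (simp add: field_simps)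
    show ?thesis
      unfolding True cube_prim2_def cube_prim_def D l
      by (simp add: field_simps eval_nat_numeral)
  qed (simp add: True cube_prim2_def)
  note eq = this
  have "continuous_on {0..} (\<lambda>u. ?k * u ^ 5 / 5)" by (intro continuous_intros) auto
  then show ?thesis by (rule continuous_on_eq) (rule eq[symmetric])
next
  case False
  then have v: "v > 0" using v by simp
  have p: "u - v * c + third_side c u v > 0" "v - u * c + third_side c u v > 0" if "u \<ge> 0" for u
  proof -
    show "u - v * c + third_side c u v > 0" using third_side_pos(4)[OF c v, of u] by (simp add: third_side_commute)
    show "v - u * c + third_side c u v > 0"
    proof (cases "u = 0")
      case True then show ?thesis using v by (simp add: third_side_def)
    next
      case False then show ?thesis using third_side_pos(4)[OF c, of u v] that by simp
    qed
  qed
  have cD: "continuous_on {0..} (\<lambda>u. third_side c u v)"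
    unfolding third_side_def by (intro continuous_intros)
  \<comment> \<open>Splitting the quotient under the logarithm isolates the singular term; at
    \<open>u = 0\<close> both forms agree because the factors in front vanish.\<close>
  have e: "cube_prim2 c u v = (u * ((v - u * c) * third_side c u v ^ 3 / 4 + 3 / 8 * (u\<^sup>2 * (1 - c\<^sup>2)) * (v - u * c) * third_side c u v)
     + 3 / 8 * (1 - c\<^sup>2)\<^sup>2 * (u ^ 5 * ln (v - u * c + third_side c u v) - u ^ 5 * ln u)
     + v * ((u - v * c) * third_side c u v ^ 3 / 4 + 3 / 8 * (v\<^sup>2 * (1 - c\<^sup>2)) * (u - v * c) * third_side c u v
     + 3 / 8 * (v\<^sup>2 * (1 - c\<^sup>2))\<^sup>2 * ln ((u - v * c + third_side c u v) / v))) / 5" if "u \<in> {0..}" for u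
  proof (cases "u = 0")
    case True then show ?thesis by (simp add: cube_prim2_def cube_prim_def third_side_commute[of c v])
  next
    case False
    then have u: "u > 0" using that by simp
    have "ln ((v - u * c + third_side c u v) / u) = ln (v - u * c + third_side c u v) - ln u"
      using p(2)[of u] u by (simp add: ln_div)
    show ?thesis unfolding cube_prim2_def cube_prim_def third_side_commute[of c v] \<open>ln (_ / u) = _\<close>
      by algebra
  qed
  show ?thesis
  proof (rule continuous_on_eq[OF _ e[symmetric]])
    have 1: "continuous_on {0..} (\<lambda>u. ln (v - u * c + third_side c u v))"
      using p(2) by (intro continuous_on_ln continuous_intros cD) force
    have 2: "continuous_on {0..} (\<lambda>u. ln ((u - v * c + third_side c u v) / v))"
      using p(1) v by (intro continuous_on_ln continuous_intros cD) force+
    show "continuous_on {0..} (\<lambda>u. (u * ((v - u * c) * third_side c u v ^ 3 / 4 + 3 / 8 * (u\<^sup>2 * (1 - c\<^sup>2)) * (v - u * c) * third_side c u v)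
     + 3 / 8 * (1 - c\<^sup>2)\<^sup>2 * (u ^ 5 * ln (v - u * c + third_side c u v) - u ^ 5 * ln u)
     + v * ((u - v * c) * third_side c u v ^ 3 / 4 + 3 / 8 * (v\<^sup>2 * (1 - c\<^sup>2)) * (u - v * c) * third_side c u v
     + 3 / 8 * (v\<^sup>2 * (1 - c\<^sup>2))\<^sup>2 * ln ((u - v * c + third_side c u v) / v))) / 5)"
      by (rule 1 2 cD continuous_power_ln | rule continuous_intros | simp)+
  qed
qed

text \<open>Two integrations give \<open>cube_prim2\<close> at the four corners with alternating
  signs. It is symmetric, so the mixed corners agree, and collecting the values of
  \<open>cube_prim\<close> produces the factor 2/5.\<close>

lemma double_integral_third_side_cube:
  assumes c: "\<bar>c\<bar> < 1" and a: "a \<ge> 0"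
  shows "integral {0..1} (\<lambda>s. integral {0..1} (\<lambda>t. third_side c (s + a) (t + a) ^ 3)) =
    2 / 5 * ((a + 1) * cube_prim c (a + 1) (a + 1) + a * cube_prim c a a
       - a * cube_prim c a (a + 1) - (a + 1) * cube_prim c (a + 1) a)"
proof -
  have inner: "integral {0..1} (\<lambda>t. third_side c u (t + a) ^ 3) = cube_prim c u (1 + a) - cube_prim c u a" if u: "u > 0" for u
  proof -
    have "((\<lambda>t. cube_prim c u (t + a)) has_real_derivative third_side c u (t + a) ^ 3) (at t)" for t
      using deriv_cube_prim(1)[OF c u, of "t + a"] by (simp add: DERIV_shift)
    then have "((\<lambda>t. third_side c u (t + a) ^ 3) has_integral (cube_prim c u (1 + a) - cube_prim c u (0 + a))) {0..1}"
      by (intro fundamental_theorem_of_calculus)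
        (auto simp: has_real_derivative_iff_has_vector_derivative[symmetric] intro: DERIV_subset)
    then show ?thesis by (simp add: integral_unique)
  qed
  let ?H = "\<lambda>s. cube_prim2 c (s + a) (1 + a) - cube_prim2 c (s + a) a"
  have "((\<lambda>s. integral {0..1} (\<lambda>t. third_side c (s + a) (t + a) ^ 3)) has_integral (?H 1 - ?H 0)) {0..1}"
  \<comment> \<open>Derivatives inside and continuity at the ends: for \<open>a = 0\<close> the left
    end is the common vertex of two adjacent sides.\<close>
  proof (rule fundamental_theorem_of_calculus_interior)
    have cc: "continuous_on {0..1} (\<lambda>s. cube_prim2 c (s + a) v)" if "v \<ge> 0" for v
      by (rule continuous_on_compose2[OF continuous_cube_prim2[OF c that], of _ "\<lambda>s. s + a"])
        (use a in \<open>auto intro!: continuous_intros\<close>)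
    show "continuous_on {0..1} ?H"
      by (intro continuous_on_diff cc) (use a in auto)
    fix s :: real assume s: "s \<in> {0<..<1}"
    have pos: "s + a > 0" using s a by simp
    have "((\<lambda>s. cube_prim2 c (s + a) v) has_real_derivative cube_prim c (s + a) v) (at s)" if "v \<ge> 0" for v
      using deriv_cube_prim2[OF c pos that] by (simp add: DERIV_shift)
    from DERIV_diff[OF this this, of "1 + a" a]
    show "(?H has_vector_derivative integral {0..1} (\<lambda>t. third_side c (s + a) (t + a) ^ 3)) (at s)"
      unfolding inner[OF pos] has_real_derivative_iff_has_vector_derivative[symmetric] using a by simp
  qed simp
  then show ?thesis
    by (simp add: integral_unique cube_prim2_def algebra_simps)
qed

subsection \<open>Evaluation in the field generated by the square roots of 2 and 3\<close>

text \<open>Square root and quotient enter as supplied values \<open>D\<close> and \<open>E\<close>,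
  certified by polynomial equations. A concrete evaluation is then pure arithmetic with the square
  roots of 2 and 3.\<close>

lemma cube_prim_value:
  assumes "u > 0" "D \<ge> 0" "D * D = u * u + v * v - 2 * u * v * c" "v - u * c = z" "z + D = E * u"
    "u * u * (1 - c * c) = p" "z * (D * (D * D)) / 4 + 3 / 8 * p * z * D = R" "3 / 8 * (p * p) = K"
  shows "cube_prim c u v = R + K * ln E"
proof -
  have D: "third_side c u v = D"
    unfolding third_side_def power2_eq_square assms(3)[symmetric] using assms(2) by simp
  have E: "(z + D) / u = E" unfolding assms(5) using assms(1) by simp
  show ?thesis
    unfolding cube_prim_def D assms(4) E power2_eq_square power3_eq_cube assms(6) assms(7)[symmetric] assms(8)[symmetric]
    by (simp only: mult.assoc)
qed

context
  fixes x y :: real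
  assumes x: "x = sqrt 2" and y: "y = sqrt 3"
begin

text \<open>Rewrite rules for a normal form in the basis \<open>1, x, y, x * y\<close> over the
  rationals; the variants with \<open>t\<close> catch squares in longer products nested to the
  right. As variables, \<open>x\<close> and \<open>y\<close> stay untouched by the rules for
  \<open>sqrt\<close>.\<close>

lemma sqrt23: "x * x = 2" "y * y = 3" "x * (x * t) = 2 * t" "y * (y * t) = 3 * t"
proof -
  show xx: "x * x = 2" and yy: "y * y = 3" by (simp_all add: x y)
  show "x * (x * t) = 2 * t" "y * (y * t) = 3 * t"
    by (simp_all only: xx yy mult.assoc[symmetric])
qed

lemma sqrt23_bounds: "1.4 < x" "x < 1.5" "1.7 < y" "y < 1.74" "x * y > 2.38"
proof -
  show "1.4 < x" unfolding x by (rule real_less_rsqrt) (simp add: power2_eq_square)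
  moreover show "1.7 < y" unfolding y by (rule real_less_rsqrt) (simp add: power2_eq_square)
  ultimately show "x * y > 2.38" using mult_strict_mono[of "1.4" x "1.7" y] by simp
  show "x < 1.5" unfolding x by (rule real_less_lsqrt) (simp_all add: power2_eq_square)
  show "y < 1.74" unfolding y by (rule real_less_lsqrt) (simp_all add: power2_eq_square)
qed

text \<open>\<open>(x * y + x) / 2\<close> and \<open>(x * y - x) / 2\<close> are the square roots
  of \<open>2 + y\<close> and \<open>2 - y\<close>, and these two numbers are inverse to each
  other.\<close>

lemma ln_sqrt23:
  "ln y = ln 3 / 2" "ln ((x * y + x) / 2) = ln (2 + y) / 2" "ln ((x * y - x) / 2) = - ln (2 + y) / 2" "ln (2 - y) = - ln (2 + y)"
proof -
  note b = sqrt23_bounds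
  have sq: "ln a = ln c / 2" if "a * a = c" "a > 0" for a c :: real
    using ln_mult_pos[of a a] that by simp
  show "ln y = ln 3 / 2" using b by (intro sq sqrt23) simp
  show "ln ((x * y + x) / 2) = ln (2 + y) / 2"
    using b by (intro sq) (simp_all add: field_simps sqrt23)
  have "(2 + y) * (2 - y) = 1" by (simp add: algebra_simps sqrt23)
  then show m: "ln (2 - y) = - ln (2 + y)"
    using b ln_mult_pos[of "2 + y" "2 - y"] by simp
  have "ln ((x * y - x) / 2) = ln (2 - y) / 2"
    using b mult_strict_mono[of 1 y x x] by (intro sq) (simp_all add: field_simps sqrt23)
  then show "ln ((x * y - x) / 2) = - ln (2 + y) / 2" unfolding m by simp
qed

lemma tau_pos: "x * y - x > 0"
  using sqrt23_bounds by linarith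


text \<open>The left-hand sides are the quotients \<open>E\<close> of the evaluations below,
  factored so that few independent logarithms remain. The logarithm of 2 will cancel: the
  coefficient of the logarithm in \<open>cube_prim c u v\<close> does not depend on
  \<open>v\<close>, and for each \<open>u\<close> two such values occur with opposite signs.\<close>

lemma ln_products:
  "ln (((x * y + x) / 2) * (2 + ((x * y + x) / 2)) * (1/2)) = (- 1) * ln 2 + (1 / 2) * ln (2 + y) + (1) * ln (2 + ((x * y + x) / 2))"
  "ln ((2 + y) * (1/2)) = (- 1) * ln 2 + (1) * ln (2 + y)"
  "ln (y * (2 + y) * (1/2)) = (- 1) * ln 2 + (1 / 2) * ln 3 + (1) * ln (2 + y)"
  "ln (y * ((x * y + x) / 2) * (2 + ((x * y + x) / 2)) * (1/2)) = (- 1) * ln 2 + (1 / 2) * ln 3 + (1 / 2) * ln (2 + y) + (1) * ln (2 + ((x * y + x) / 2))"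
  "ln (y * (1 + x) * (1/2)) = (- 1) * ln 2 + (1 / 2) * ln 3 + (1) * ln (1 + x)"
  "ln ((1 + x)) = (1) * ln (1 + x)"
  "ln ((2 + y)) = (1) * ln (2 + y)"
  "ln (y) = (1 / 2) * ln 3"
  "ln ((3::real) * (1/2)) = (- 1) * ln 2 + (1) * ln 3"
  "ln (y * (1 + x) * (1/2)) = (- 1) * ln 2 + (1 / 2) * ln 3 + (1) * ln (1 + x)"
  "ln (y * ((x * y - x) / 2) * (2 + ((x * y - x) / 2)) * (1/2)) = (- 1) * ln 2 + (1 / 2) * ln 3 + (- 1 / 2) * ln (2 + y) + (1) * ln (2 + ((x * y - x) / 2))"
  "ln (((x * y - x) / 2) * (2 + ((x * y - x) / 2)) * (1/2)) = (- 1) * ln 2 + (- 1 / 2) * ln (2 + y) + (1) * ln (2 + ((x * y - x) / 2))"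
  "ln (y * (1/2)) = (- 1) * ln 2 + (1 / 2) * ln 3"
  "ln ((1/2::real)) = (- 1) * ln 2"
proof -
  note b = sqrt23_bounds tau_pos
  have pos: "x > 0" "y > 0" "1 + x > 0" "2 + y > 0" "(x * y + x) / 2 > 0" "2 + (x * y + x) / 2 > 0" "(x * y - x) / 2 > 0" "2 + (x * y - x) / 2 > 0"
    using b by (auto intro: add_pos_pos)
  have half: "ln (1 / 2 :: real) = - ln 2" by (simp add: ln_div)
  have mult: "ln (a * c) = ln a + ln c" if "a > 0" "c > 0" for a c :: real
    using that by (rule ln_mult_pos)
  note pos = pos mult_pos_pos[OF pos(2) pos(4)] mult_pos_pos[OF pos(2) pos(5)] mult_pos_pos[OF pos(2) pos(3)]
    mult_pos_pos[OF pos(2) pos(7)] mult_pos_pos[OF pos(5) pos(6)] mult_pos_pos[OF pos(7) pos(8)]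
  note pos = pos mult_pos_pos[OF mult_pos_pos[OF pos(2) pos(5)] pos(6)] mult_pos_pos[OF mult_pos_pos[OF pos(2) pos(7)] pos(8)]
  have n: "(0::real) < 1 / 2" "(0::real) < 3" by simp_all
  show "ln (((x * y + x) / 2) * (2 + ((x * y + x) / 2)) * (1/2)) = (- 1) * ln 2 + (1 / 2) * ln (2 + y) + (1) * ln (2 + ((x * y + x) / 2))"
    by (simp only: mult[OF _ n(1)] mult pos n half ln_sqrt23) (simp add: field_simps)?
  show "ln ((2 + y) * (1/2)) = (- 1) * ln 2 + (1) * ln (2 + y)"
    by (simp only: mult[OF _ n(1)] mult pos n half ln_sqrt23) (simp add: field_simps)?
  show "ln (y * (2 + y) * (1/2)) = (- 1) * ln 2 + (1 / 2) * ln 3 + (1) * ln (2 + y)"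
    by (simp only: mult[OF _ n(1)] mult pos n half ln_sqrt23) (simp add: field_simps)?
  show "ln (y * ((x * y + x) / 2) * (2 + ((x * y + x) / 2)) * (1/2)) = (- 1) * ln 2 + (1 / 2) * ln 3 + (1 / 2) * ln (2 + y) + (1) * ln (2 + ((x * y + x) / 2))"
    by (simp only: mult[OF _ n(1)] mult pos n half ln_sqrt23) (simp add: field_simps)?
  show "ln (y * (1 + x) * (1/2)) = (- 1) * ln 2 + (1 / 2) * ln 3 + (1) * ln (1 + x)"
    by (simp only: mult[OF _ n(1)] mult pos n half ln_sqrt23) (simp add: field_simps)?
  show "ln ((1 + x)) = (1) * ln (1 + x)"
    by (simp only: mult[OF _ n(1)] mult pos n half ln_sqrt23) (simp add: field_simps)?
  show "ln ((2 + y)) = (1) * ln (2 + y)"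
    by (simp only: mult[OF _ n(1)] mult pos n half ln_sqrt23) (simp add: field_simps)?
  show "ln (y) = (1 / 2) * ln 3"
    by (simp only: mult[OF _ n(1)] mult pos n half ln_sqrt23) (simp add: field_simps)?
  show "ln ((3::real) * (1/2)) = (- 1) * ln 2 + (1) * ln 3"
    by (simp only: mult[OF _ n(1)] mult pos n half ln_sqrt23) (simp add: field_simps)?
  show "ln (y * (1 + x) * (1/2)) = (- 1) * ln 2 + (1 / 2) * ln 3 + (1) * ln (1 + x)"
    by (simp only: mult[OF _ n(1)] mult pos n half ln_sqrt23) (simp add: field_simps)?
  show "ln (y * ((x * y - x) / 2) * (2 + ((x * y - x) / 2)) * (1/2)) = (- 1) * ln 2 + (1 / 2) * ln 3 + (- 1 / 2) * ln (2 + y) + (1) * ln (2 + ((x * y - x) / 2))"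
    by (simp only: mult[OF _ n(1)] mult pos n half ln_sqrt23) (simp add: field_simps)?
  show "ln (((x * y - x) / 2) * (2 + ((x * y - x) / 2)) * (1/2)) = (- 1) * ln 2 + (- 1 / 2) * ln (2 + y) + (1) * ln (2 + ((x * y - x) / 2))"
    by (simp only: mult[OF _ n(1)] mult pos n half ln_sqrt23) (simp add: field_simps)?
  show "ln (y * (1/2)) = (- 1) * ln 2 + (1 / 2) * ln 3"
    by (simp only: mult[OF _ n(1)] mult pos n half ln_sqrt23) (simp add: field_simps)?
  show "ln ((1/2::real)) = (- 1) * ln 2"
    by (simp only: mult[OF _ n(1)] mult pos n half ln_sqrt23) (simp add: field_simps)?
qed

text \<open>The lines through sides \<open>0\<close> and \<open>m\<close> of a dodecagon with unit sides meet at distance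
  \<open>a = ((2 + sqrt 3) * tan (m * pi / 12) - 1) / 2\<close> from the nearer end points, at an angle with cosine
  \<open>c = - cos (m * pi / 6)\<close>. The next five lemmas treat \<open>m = 1, \<dots>, 5\<close>; sides \<open>0\<close> and \<open>6\<close> are parallel at
  distance \<open>2 + sqrt 3\<close>.\<close>
lemma double_integral_1:
  "integral {0..1} (\<lambda>s. integral {0..1} (\<lambda>t. third_side (- 1 / 2 * y) (s + (0)) (t + (0)) ^ 3)) =
    (167 / 320 * x - 11 / 160 * y + 97 / 320 * (x * y)) + (- 3 / 640) * ln (2 + y) + (3 / 320) * ln (2 + ((x * y + x) / 2))"
proof -
  note b = sqrt23_bounds tau_pos
  have c: "\<bar>(- 1 / 2 * y) :: real\<bar> < 1" using b by simp
  have a: "((0)::real) \<ge> 0" using b by simp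
  have step: "(0) + 1 = ((1)::real)" by (simp add: field_simps)
  \<comment> \<open>With \<open>a = 0\<close> only the corners with first argument 1 carry weight.
    In all five evaluations \<open>D\<close> is a distance between vertices, that is, the unit side
    or a diagonal: \<open>1\<close>, \<open>(x + x * y) / 2\<close>, \<open>1 + y\<close>,
    \<open>(3 * x + x * y) / 2\<close>, \<open>2 + y\<close> or \<open>x + x * y\<close>.\<close>
  have bb: "cube_prim (- 1 / 2 * y) (1) (1) = (167 / 128 * x + 97 / 128 * (x * y)) + (3 / 128) * ((- 1) * ln 2 + (1 / 2) * ln (2 + y) + (1) * ln (2 + ((x * y + x) / 2)))"
    unfolding ln_products(1)[symmetric]
    by (rule cube_prim_value[where D = "1 / 2 * x + 1 / 2 * (x * y)" and z = "1 + 1 / 2 * y" and p = "1 / 4"])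
      (use b in \<open>simp_all add: field_simps sqrt23\<close>)
  have b0: "cube_prim (- 1 / 2 * y) (1) (0) = (11 / 64 * y) + (3 / 128) * ((- 1) * ln 2 + (1) * ln (2 + y))"
    unfolding ln_products(2)[symmetric]
    by (rule cube_prim_value[where D = "1" and z = "1 / 2 * y" and p = "1 / 4"])
      (use b in \<open>simp_all add: field_simps sqrt23\<close>)
  show ?thesis
    unfolding double_integral_third_side_cube[OF c a] step bb b0
    by (simp add: field_simps sqrt23)
qed

lemma double_integral_2:
  "integral {0..1} (\<lambda>s. integral {0..1} (\<lambda>t. third_side (- 1 / 2) (s + (1 / 3 * y)) (t + (1 / 3 * y)) ^ 3)) =
    (847 / 160 - 81 / 64 * x + 121 / 40 * y - 233 / 320 * (x * y)) + (- 33 / 80 - 19 / 80 * y) * ln (1 + x) + (33 / 80 + 153 / 640 * y) * ln (2 + y) + (- 1 / 320 * y) * ln (2 + ((x * y + x) / 2))"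
proof -
  note b = sqrt23_bounds tau_pos
  have c: "\<bar>(- 1 / 2) :: real\<bar> < 1" using b by simp
  have a: "((1 / 3 * y)::real) \<ge> 0" using b by simp
  have step: "(1 / 3 * y) + 1 = ((1 + 1 / 3 * y)::real)" by (simp add: field_simps)
  have bb: "cube_prim (- 1 / 2) (1 + 1 / 3 * y) (1 + 1 / 3 * y) = (33 / 4 + 77 / 16 * y) + (21 / 32 + 3 / 8 * y) * ((- 1) * ln 2 + (1 / 2) * ln 3 + (1) * ln (2 + y))"
    unfolding ln_products(3)[symmetric]
    by (rule cube_prim_value[where D = "1 + y" and z = "3 / 2 + 1 / 2 * y" and p = "1 + 1 / 2 * y"])
      (use b in \<open>simp_all add: field_simps sqrt23\<close>)
  have aa: "cube_prim (- 1 / 2) (1 / 3 * y) (1 / 3 * y) = (11 / 64 * y) + (3 / 128) * ((- 1) * ln 2 + (1 / 2) * ln 3 + (1) * ln (2 + y))"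
    unfolding ln_products(3)[symmetric]
    by (rule cube_prim_value[where D = "1" and z = "1 / 2 * y" and p = "1 / 4"])
      (use b in \<open>simp_all add: field_simps sqrt23\<close>)
  have ab: "cube_prim (- 1 / 2) (1 / 3 * y) (1 + 1 / 3 * y) = (167 / 128 * x + 97 / 128 * (x * y)) + (3 / 128) * ((- 1) * ln 2 + (1 / 2) * ln 3 + (1 / 2) * ln (2 + y) + (1) * ln (2 + ((x * y + x) / 2)))"
    unfolding ln_products(4)[symmetric]
    by (rule cube_prim_value[where D = "1 / 2 * x + 1 / 2 * (x * y)" and z = "1 + 1 / 2 * y" and p = "1 / 4"])
      (use b in \<open>simp_all add: field_simps sqrt23\<close>)
  have ba: "cube_prim (- 1 / 2) (1 + 1 / 3 * y) (1 / 3 * y) = (49 / 32 * x + 7 / 8 * (x * y)) + (21 / 32 + 3 / 8 * y) * ((- 1) * ln 2 + (1 / 2) * ln 3 + (1) * ln (1 + x))"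
    unfolding ln_products(5)[symmetric]
    by (rule cube_prim_value[where D = "1 / 2 * x + 1 / 2 * (x * y)" and z = "1 / 2 + 1 / 2 * y" and p = "1 + 1 / 2 * y"])
      (use b in \<open>simp_all add: field_simps sqrt23\<close>)
  show ?thesis
    unfolding double_integral_third_side_cube[OF c a] step bb aa ab ba
    by (simp add: field_simps sqrt23)
qed

lemma double_integral_3:
  "integral {0..1} (\<lambda>s. integral {0..1} (\<lambda>t. third_side (0) (s + (1 / 2 + 1 / 2 * y)) (t + (1 / 2 + 1 / 2 * y)) ^ 3)) =
    (- 231 / 20 + 553 / 40 * x - 133 / 20 * y + 637 / 80 * (x * y)) + (- 891 / 320 - 513 / 320 * y) * ln 3 + (237 / 40 + 273 / 80 * y) * ln (1 + x) + (- 57 / 160 - 33 / 160 * y) * ln (2 + y)"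
proof -
  note b = sqrt23_bounds tau_pos
  have c: "\<bar>(0) :: real\<bar> < 1" using b by simp
  have a: "((1 / 2 + 1 / 2 * y)::real) \<ge> 0" using b by simp
  have step: "(1 / 2 + 1 / 2 * y) + 1 = ((3 / 2 + 1 / 2 * y)::real)" by (simp add: field_simps)
  have bb: "cube_prim (0) (3 / 2 + 1 / 2 * y) (3 / 2 + 1 / 2 * y) = (441 / 32 * x + 63 / 8 * (x * y)) + (189 / 32 + 27 / 8 * y) * ((1) * ln (1 + x))"
    unfolding ln_products(6)[symmetric]
    by (rule cube_prim_value[where D = "3 / 2 * x + 1 / 2 * (x * y)" and z = "3 / 2 + 1 / 2 * y" and p = "3 + 3 / 2 * y"])
      (use b in \<open>simp_all add: field_simps sqrt23\<close>)
  have aa: "cube_prim (0) (1 / 2 + 1 / 2 * y) (1 / 2 + 1 / 2 * y) = (49 / 32 * x + 7 / 8 * (x * y)) + (21 / 32 + 3 / 8 * y) * ((1) * ln (1 + x))"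
    unfolding ln_products(6)[symmetric]
    by (rule cube_prim_value[where D = "1 / 2 * x + 1 / 2 * (x * y)" and z = "1 / 2 + 1 / 2 * y" and p = "1 + 1 / 2 * y"])
      (use b in \<open>simp_all add: field_simps sqrt23\<close>)
  have ab: "cube_prim (0) (1 / 2 + 1 / 2 * y) (3 / 2 + 1 / 2 * y) = (33 / 4 + 77 / 16 * y) + (21 / 32 + 3 / 8 * y) * ((1) * ln (2 + y))"
    unfolding ln_products(7)[symmetric]
    by (rule cube_prim_value[where D = "1 + y" and z = "3 / 2 + 1 / 2 * y" and p = "1 + 1 / 2 * y"])
      (use b in \<open>simp_all add: field_simps sqrt23\<close>)
  have ba: "cube_prim (0) (3 / 2 + 1 / 2 * y) (1 / 2 + 1 / 2 * y) = (119 / 16 + 17 / 4 * y) + (189 / 32 + 27 / 8 * y) * ((1 / 2) * ln 3)"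
    unfolding ln_products(8)[symmetric]
    by (rule cube_prim_value[where D = "1 + y" and z = "1 / 2 + 1 / 2 * y" and p = "3 + 3 / 2 * y"])
      (use b in \<open>simp_all add: field_simps sqrt23\<close>)
  show ?thesis
    unfolding double_integral_third_side_cube[OF c a] step bb aa ab ba
    by (simp add: field_simps sqrt23)
qed

lemma double_integral_4:
  "integral {0..1} (\<lambda>s. integral {0..1} (\<lambda>t. third_side (1 / 2) (s + (1 + y)) (t + (1 + y)) ^ 3)) =
    (3723 / 80 - 8073 / 320 * x + 4301 / 160 * y - 4671 / 320 * (x * y)) + (5913 / 320 + 6831 / 640 * y) * ln 3 + (- 513 / 80 - 297 / 80 * y) * ln (1 + x) + (4887 / 320 + 5643 / 640 * y) * ln (2 + y) + (- 4887 / 160 - 5643 / 320 * y) * ln (2 + ((x * y - x) / 2))"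
proof -
  note b = sqrt23_bounds tau_pos
  have c: "\<bar>(1 / 2) :: real\<bar> < 1" using b by simp
  have a: "((1 + y)::real) \<ge> 0" using b by simp
  have step: "(1 + y) + 1 = ((2 + y)::real)" by (simp add: field_simps)
  have bb: "cube_prim (1 / 2) (2 + y) (2 + y) = (1649 / 64 + 119 / 8 * y) + (2619 / 128 + 189 / 16 * y) * ((- 1) * ln 2 + (1) * ln 3)"
    unfolding ln_products(9)[symmetric]
    by (rule cube_prim_value[where D = "2 + y" and z = "1 + 1 / 2 * y" and p = "21 / 4 + 3 * y"])
      (use b in \<open>simp_all add: field_simps sqrt23\<close>)
  have aa: "cube_prim (1 / 2) (1 + y) (1 + y) = (119 / 16 + 17 / 4 * y) + (189 / 32 + 27 / 8 * y) * ((- 1) * ln 2 + (1) * ln 3)"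
    unfolding ln_products(9)[symmetric]
    by (rule cube_prim_value[where D = "1 + y" and z = "1 / 2 + 1 / 2 * y" and p = "3 + 3 / 2 * y"])
      (use b in \<open>simp_all add: field_simps sqrt23\<close>)
  have ab: "cube_prim (1 / 2) (1 + y) (2 + y) = (441 / 32 * x + 63 / 8 * (x * y)) + (189 / 32 + 27 / 8 * y) * ((- 1) * ln 2 + (1 / 2) * ln 3 + (1) * ln (1 + x))"
    unfolding ln_products(10)[symmetric]
    by (rule cube_prim_value[where D = "3 / 2 * x + 1 / 2 * (x * y)" and z = "3 / 2 + 1 / 2 * y" and p = "3 + 3 / 2 * y"])
      (use b in \<open>simp_all add: field_simps sqrt23\<close>)
  have ba: "cube_prim (1 / 2) (2 + y) (1 + y) = (873 / 128 * x + 513 / 128 * (x * y)) + (2619 / 128 + 189 / 16 * y) * ((- 1) * ln 2 + (1 / 2) * ln 3 + (- 1 / 2) * ln (2 + y) + (1) * ln (2 + ((x * y - x) / 2)))"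
    unfolding ln_products(11)[symmetric]
    by (rule cube_prim_value[where D = "3 / 2 * x + 1 / 2 * (x * y)" and z = "1 / 2 * y" and p = "21 / 4 + 3 * y"])
      (use b in \<open>simp_all add: field_simps sqrt23\<close>)
  show ?thesis
    unfolding double_integral_third_side_cube[OF c a] step bb aa ab ba
    by (simp add: field_simps sqrt23)
qed

lemma double_integral_5:
  "integral {0..1} (\<lambda>s. integral {0..1} (\<lambda>t. third_side (1 / 2 * y) (s + (3 + 2 * y)) (t + (3 + 2 * y)) ^ 3)) =
    (- 10659 / 160 + 17377 / 320 * x - 3077 / 80 * y + 10037 / 320 * (x * y)) + (- 16929 / 640 - 4887 / 320 * y) * ln 3 + (- 51681 / 640 - 14919 / 320 * y) * ln (2 + y) + (51681 / 320 + 14919 / 160 * y) * ln (2 + ((x * y - x) / 2))"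
proof -
  note b = sqrt23_bounds tau_pos
  have c: "\<bar>(1 / 2 * y) :: real\<bar> < 1" using b by simp
  have a: "((3 + 2 * y)::real) \<ge> 0" using b by simp
  have step: "(3 + 2 * y) + 1 = ((4 + 2 * y)::real)" by (simp add: field_simps)
  have bb: "cube_prim (1 / 2 * y) (4 + 2 * y) (4 + 2 * y) = (97 / 8 * x + 57 / 8 * (x * y)) + (291 / 8 + 21 * y) * ((- 1) * ln 2 + (- 1 / 2) * ln (2 + y) + (1) * ln (2 + ((x * y - x) / 2)))"
    unfolding ln_products(12)[symmetric]
    by (rule cube_prim_value[where D = "x + (x * y)" and z = "1" and p = "7 + 4 * y"])
      (use b in \<open>simp_all add: field_simps sqrt23\<close>)
  have aa: "cube_prim (1 / 2 * y) (3 + 2 * y) (3 + 2 * y) = (873 / 128 * x + 513 / 128 * (x * y)) + (2619 / 128 + 189 / 16 * y) * ((- 1) * ln 2 + (- 1 / 2) * ln (2 + y) + (1) * ln (2 + ((x * y - x) / 2)))"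
    unfolding ln_products(12)[symmetric]
    by (rule cube_prim_value[where D = "3 / 2 * x + 1 / 2 * (x * y)" and z = "1 / 2 * y" and p = "21 / 4 + 3 * y"])
      (use b in \<open>simp_all add: field_simps sqrt23\<close>)
  have ab: "cube_prim (1 / 2 * y) (3 + 2 * y) (4 + 2 * y) = (1649 / 64 + 119 / 8 * y) + (2619 / 128 + 189 / 16 * y) * ((- 1) * ln 2 + (1 / 2) * ln 3)"
    unfolding ln_products(13)[symmetric]
    by (rule cube_prim_value[where D = "2 + y" and z = "1 + 1 / 2 * y" and p = "21 / 4 + 3 * y"])
      (use b in \<open>simp_all add: field_simps sqrt23\<close>)
  \<comment> \<open>\<open>z = 0\<close>: the diagonal from this far end point meets the near end
    point of the other side at a right angle, so that only the logarithm survives.\<close>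
  have ba: "cube_prim (1 / 2 * y) (4 + 2 * y) (3 + 2 * y) = (0) + (291 / 8 + 21 * y) * ((- 1) * ln 2)"
    unfolding ln_products(14)[symmetric]
    by (rule cube_prim_value[where D = "2 + y" and z = "0" and p = "7 + 4 * y"])
      (use b in \<open>simp_all add: field_simps sqrt23\<close>)
  show ?thesis
    unfolding double_integral_third_side_cube[OF c a] step bb aa ab ba
    by (simp add: field_simps sqrt23)
qed

end

section \<open>Opposite sides, and a side paired with itself\<close>

text \<open>For \<open>c = 0\<close> the logarithm is \<open>arsinh (z / h)\<close>, an odd
  function: the two arguments have product 1.\<close>

lemma ln_third_side_minus:
  assumes h: "h > 0"
  shows "ln ((- z + third_side 0 h (- z)) / h) = - ln ((z + third_side 0 h z) / h)"
proof -
  have D: "third_side 0 h (- z) = third_side 0 h z" by (simp add: third_side_def)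
  have p: "z + third_side 0 h z > 0" "- z + third_side 0 h z > 0" "(third_side 0 h z)\<^sup>2 = h\<^sup>2 + z\<^sup>2"
    using third_side_pos[of 0 h z] third_side_pos(4)[of 0 h "- z"] h by (simp_all add: D)
  have "(- z + third_side 0 h z) / h * ((z + third_side 0 h z) / h) = 1"
    using h p(3) by (simp add: field_simps power2_eq_square)
  then have "ln ((- z + third_side 0 h z) / h) + ln ((z + third_side 0 h z) / h) = 0"
    using ln_mult_pos[of "(- z + third_side 0 h z) / h" "(z + third_side 0 h z) / h"] p h by simp
  then show ?thesis unfolding D by simp
qed

text \<open>The integrand depends on \<open>t - s\<close> only, so a second primitive
  \<open>P\<close> in this difference gives \<open>P 1 - 2 * P 0 + P (- 1)\<close>, and
  \<open>P\<close> is even.\<close>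

lemma double_integral_parallel:
  assumes h: "h > 0"
  shows "integral {0..1} (\<lambda>t. integral {0..1} (\<lambda>s. third_side 0 h (t - s) ^ 3)) =
    2 * (third_side 0 h 1 ^ 5 / 20 + h\<^sup>2 * third_side 0 h 1 ^ 3 / 8 + 3 / 8 * h ^ 4 * (ln ((1 + third_side 0 h 1) / h) - third_side 0 h 1) + h ^ 5 / 5)"
proof -
  \<comment> \<open>A primitive of \<open>cube_prim 0 h\<close>, term by term; the last bracket is
    the usual primitive of \<open>arsinh (z / h)\<close>.\<close>
  define P where "P = (\<lambda>z. third_side 0 h z ^ 5 / 20 + h\<^sup>2 * third_side 0 h z ^ 3 / 8 + 3 / 8 * h ^ 4 * (z * ln ((z - h * 0 + third_side 0 h z) / h) - third_side 0 h z))"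
  have c: "\<bar>0::real\<bar> < 1" by simp
  have inner: "integral {0..1} (\<lambda>s. third_side 0 h (t - s) ^ 3) = cube_prim 0 h t - cube_prim 0 h (t - 1)" for t
  proof -
    have "((\<lambda>s. - cube_prim 0 h (t - s)) has_real_derivative third_side 0 h (t - s) ^ 3) (at s)" for s
      using DERIV_minus[OF DERIV_chain2[where f = "cube_prim 0 h" and g = "\<lambda>s. t - s" and x = s, OF deriv_cube_prim(1)[OF c h] DERIV_diff[OF DERIV_const DERIV_ident]]] by simp
    then have "((\<lambda>s. third_side 0 h (t - s) ^ 3) has_integral (- cube_prim 0 h (t - 1) - - cube_prim 0 h (t - 0))) {0..1}"
      by (intro fundamental_theorem_of_calculus)
        (auto simp: has_real_derivative_iff_has_vector_derivative[symmetric] intro: DERIV_subset)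
    then show ?thesis by (simp add: integral_unique)
  qed
  have dP: "(P has_real_derivative cube_prim 0 h z) (at z)" for z
  proof -
    let ?D = "third_side 0 h z" and ?l = "ln ((z - h * 0 + third_side 0 h z) / h)"
    have aux: "((\<lambda>x. D x ^ 5 / 20 + h\<^sup>2 * D x ^ 3 / 8 + 3 / 8 * h ^ 4 * (x * l x - D x)) has_real_derivative
        (5 * D z ^ 4 * D') / 20 + h\<^sup>2 * (3 * (D z)\<^sup>2 * D') / 8 + 3 / 8 * h ^ 4 * (l z + z * l' - D')) (at z)"
      if "(D has_real_derivative D') (at z)" "(l has_real_derivative l') (at z)" for D l :: "real \<Rightarrow> real" and D' l'
      by (auto intro!: derivative_eq_intros that simp: field_simps)
    have "(P has_real_derivative (5 * ?D ^ 4 * ((z - h * 0) / ?D)) / 20 + h\<^sup>2 * (3 * ?D\<^sup>2 * ((z - h * 0) / ?D)) / 8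
       + 3 / 8 * h ^ 4 * (?l + z * (1 / ?D) - (z - h * 0) / ?D)) (at z)"
      unfolding P_def by (rule aux[OF deriv_third_side(1)[OF c h] deriv_ln_third_side(1)[OF c h]])
    also have "(5 * ?D ^ 4 * ((z - h * 0) / ?D)) / 20 + h\<^sup>2 * (3 * ?D\<^sup>2 * ((z - h * 0) / ?D)) / 8
       + 3 / 8 * h ^ 4 * (?l + z * (1 / ?D) - (z - h * 0) / ?D) = cube_prim 0 h z"
    proof -
      have "?D \<noteq> 0" using third_side_pos(2)[OF c h, of z] by simp
      then have "?D ^ 4 * (z / ?D) = z * ?D ^ 3" "?D\<^sup>2 * (z / ?D) = z * ?D"
        by (simp_all add: power2_eq_square eval_nat_numeral)
      then show ?thesis unfolding cube_prim_def by (simp add: field_simps eval_nat_numeral)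
    qed
    finally show ?thesis .
  qed
  have "((\<lambda>t. P t - P (t - 1)) has_real_derivative cube_prim 0 h t - cube_prim 0 h (t - 1)) (at t)" for t
    using DERIV_diff[OF dP[of t] DERIV_chain2[where f = P and g = "\<lambda>t. t - 1" and x = t, OF dP DERIV_diff[OF DERIV_ident DERIV_const]]] by simp
  then have "((\<lambda>t. cube_prim 0 h t - cube_prim 0 h (t - 1)) has_integral ((P 1 - P (1 - 1)) - (P 0 - P (0 - 1)))) {0..1}"
    by (intro fundamental_theorem_of_calculus)
      (auto simp: has_real_derivative_iff_has_vector_derivative[symmetric] intro: DERIV_subset)
  then have "integral {0..1} (\<lambda>t. integral {0..1} (\<lambda>s. third_side 0 h (t - s) ^ 3)) = P 1 - 2 * P 0 + P (- 1)"
    unfolding inner by (simp add: integral_unique)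
  also have "P (- 1) = P 1"
    unfolding P_def using ln_third_side_minus[OF h, of 1] by (simp add: third_side_def)
  also have "P 0 = - (h ^ 5 / 5)"
    unfolding P_def third_side_def using h by (simp add: field_simps eval_nat_numeral)
  finally show ?thesis unfolding P_def by (simp add: field_simps)
qed

lemma double_integral_collinear:
  "integral {0..1} (\<lambda>t. integral {0..1} (\<lambda>s. \<bar>t - s\<bar> ^ 3)) = (1 / 10 :: real)"
proof -
  have inner: "integral {0..1} (\<lambda>s. \<bar>t - s\<bar> ^ 3) = t ^ 4 / 4 + (1 - t) ^ 4 / 4" if "t \<in> {0..1}" for t :: real
  proof -
    have "((\<lambda>s. \<bar>t - s\<bar> ^ 3) has_integral (- ((t - t) ^ 4 / 4) - - ((t - 0) ^ 4 / 4))) {0..t}"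
      by (rule fundamental_theorem_of_calculus)
        (use that in \<open>auto simp: has_real_derivative_iff_has_vector_derivative[symmetric] intro!: derivative_eq_intros\<close>)
    moreover have "((\<lambda>s. \<bar>t - s\<bar> ^ 3) has_integral ((1 - t) ^ 4 / 4 - (t - t) ^ 4 / 4)) {t..1}"
      by (rule fundamental_theorem_of_calculus)
        (use that in \<open>auto simp: has_real_derivative_iff_has_vector_derivative[symmetric] intro!: derivative_eq_intros\<close>)
    ultimately have "((\<lambda>s. \<bar>t - s\<bar> ^ 3) has_integral ((- ((t - t) ^ 4 / 4) - - ((t - 0) ^ 4 / 4)) + ((1 - t) ^ 4 / 4 - (t - t) ^ 4 / 4))) {0..1}"
      using that by (intro has_integral_combine[where a = 0 and b = 1 and c = t]) auto
    then show ?thesis by (simp add: integral_unique)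
  qed
  have "((\<lambda>t::real. t ^ 4 / 4 + (1 - t) ^ 4 / 4) has_integral ((1 ^ 5 / 20 - (1 - 1) ^ 5 / 20) - (0 ^ 5 / 20 - (1 - 0) ^ 5 / 20))) {0..1}"
    by (rule fundamental_theorem_of_calculus)
      (auto simp: has_real_derivative_iff_has_vector_derivative[symmetric] intro!: derivative_eq_intros)
  then have "integral {0..1} (\<lambda>t::real. t ^ 4 / 4 + (1 - t) ^ 4 / 4) = 1 / 10"
    by (simp add: integral_unique)
  then show ?thesis
    using inner by (subst Henstock_Kurzweil_Integration.integral_cong[OF inner]) auto
qed

context
  fixes x y :: real
  assumes x: "x = sqrt 2" and y: "y = sqrt 3"
begin

lemma double_integral_6:
  "integral {0..1} (\<lambda>t. integral {0..1} (\<lambda>s. third_side 0 (2 + y) (t - s) ^ 3)) =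
    (724 / 5 - 1947 / 20 * x + 418 / 5 * y - 1123 / 20 * (x * y)) + (- 291 / 8 - 21 * y) * ln (2 + y) + (291 / 4 + 42 * y) * ln (2 + ((x * y - x) / 2))"
proof -
  note b = sqrt23_bounds[OF x y] tau_pos[OF x y] and r = sqrt23[OF x y]
  have h: "2 + y > 0" using b by linarith
  have "x * y + x \<ge> 0" using b by linarith
  \<comment> \<open>Pythagoras in the rectangle formed by two opposite sides: its diagonal is the
    diameter \<open>x * y + x\<close>.\<close>
  moreover have "(x * y + x) * (x * y + x) = 1 + (2 + y) * (2 + y)" by (simp add: algebra_simps r)
  ultimately have D: "third_side 0 (2 + y) 1 = x * y + x"
    unfolding third_side_def by (intro real_sqrt_unique) (simp_all add: power2_eq_square)
  \<comment> \<open>Division by \<open>2 + y\<close> is multiplication by \<open>2 - y\<close>, the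
    square of \<open>(x * y - x) / 2\<close>.\<close>
  have e: "(1 + (x * y + x)) / (2 + y) = (x * y - x) / 2 * (2 + (x * y - x) / 2)"
    using h by (simp add: field_simps r)
  have t: "(x * y - x) / 2 > 0" "2 + (x * y - x) / 2 > 0" using b by (auto intro: add_pos_pos)
  have l: "ln ((1 + (x * y + x)) / (2 + y)) = - ln (2 + y) / 2 + ln (2 + (x * y - x) / 2)"
    unfolding e ln_mult_pos[OF t] ln_sqrt23(3)[OF x y] ..
  have p: "(x * y + x) ^ 5 = 304 * x + 176 * (x * y)" "(x * y + x) ^ 3 = 20 * x + 12 * (x * y)" "(2 + y) ^ 4 = 97 + 56 * y" "(2 + y)\<^sup>2 = 7 + 4 * y" "(2 + y) ^ 5 = 362 + 209 * y"
    by (simp_all add: eval_nat_numeral field_simps r)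
  show ?thesis
    unfolding double_integral_parallel[OF h] D l p by (simp add: field_simps r)
qed

end

section \<open>Rotational symmetry of the pairs of sides\<close>

lemma vertex_add: "vertex r (j + m) = cis (real j * pi / 6) * vertex r m"
  unfolding vertex_def by (simp add: cis_mult algebra_simps add_divide_distrib)

lemma vertex_add12: "vertex r (k + 12) = vertex r k"
  using vertex_add6[of r "k + 6"] vertex_add6[of r k] by (simp add: add.assoc)

lemma vertex_mod: "vertex r (k mod 12) = vertex r k"
proof -
  have "vertex r (m + 12 * q) = vertex r m" for m q
  proof (induction q)
    case (Suc q)
    then show ?case using vertex_add12[of r "m + 12 * q"] by (simp add: algebra_simps)
  qed simp
  from this[of "k mod 12" "k div 12"] show ?thesis by simp
qed

lemma vertex_mod_Suc: "vertex r (Suc (k mod 12)) = vertex r (Suc k)"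
  using vertex_mod[of r "Suc (k mod 12)"] vertex_mod[of r "Suc k"] by (simp add: mod_Suc_eq)

lemma vertex_rotate:
  assumes "j < 12" "(j + m) mod 12 = k mod 12"
  shows "vertex r k = cis (real j * pi / 6) * vertex r m"
    "vertex r (Suc k) = cis (real j * pi / 6) * vertex r (Suc m)"
proof -
  show "vertex r k = cis (real j * pi / 6) * vertex r m"
    using vertex_mod[of r k] vertex_mod[of r "j + m"] assms(2) vertex_add[of r j m] by simp
  show "vertex r (Suc k) = cis (real j * pi / 6) * vertex r (Suc m)"
    using vertex_mod_Suc[of r k] vertex_mod_Suc[of r "j + m"] assms(2) vertex_add[of r j "Suc m"] by simp
qed

lemma cis_inner: "(cis a * z) \<bullet> (cis a * w) = z \<bullet> w"
proof -
  have "(c * p - s * q) * (c * p' - s * q') + (c * q + s * p) * (c * q' + s * p') = (s\<^sup>2 + c\<^sup>2) * (p * p' + q * q')" for c s p q p' q' :: real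
    by (simp add: algebra_simps power2_eq_square)
  from this[of "cos a" "Re z" "sin a" "Im z" "Re w" "Im w"] show ?thesis
    by (simp add: inner_complex_def)
qed

definition edge_integral :: "real \<Rightarrow> nat \<Rightarrow> real" where
  "edge_integral r m = integral {0..1} (\<lambda>t. integral {0..1} (\<lambda>s. cmod (edge r m t - edge r 0 s) ^ 3))"

text \<open>The rotation that carries side 0 to side \<open>j\<close> carries side \<open>m\<close>
  to side \<open>k\<close>, and it preserves distances and inner products.\<close>

lemma edge_pair_rotate:
  assumes "j < 12" "(j + m) mod 12 = k mod 12"
  shows "integral {0..1} (\<lambda>t. integral {0..1} (\<lambda>s. cmod (edge r k t - edge r j s) ^ 3)) = edge_integral r m"
    "side r j \<bullet> side r k = side r 0 \<bullet> side r m"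
proof -
  note k = vertex_rotate[OF assms, of r]
  have j: "vertex r j = cis (real j * pi / 6) * vertex r 0" "vertex r (Suc j) = cis (real j * pi / 6) * vertex r (Suc 0)"
    using vertex_rotate[of j 0 j r] assms(1) by simp_all
  have "edge r k t - edge r j s = cis (real j * pi / 6) * (edge r m t - edge r 0 s)" for s t
    unfolding edge_def k j by (simp add: algebra_simps)
  then have "cmod (edge r k t - edge r j s) = cmod (edge r m t - edge r 0 s)" for s t
    by (simp add: norm_mult)
  then show "integral {0..1} (\<lambda>t. integral {0..1} (\<lambda>s. cmod (edge r k t - edge r j s) ^ 3)) = edge_integral r m"
    unfolding edge_integral_def by simp
  have "side r j = cis (real j * pi / 6) * side r 0" "side r k = cis (real j * pi / 6) * side r m"
    unfolding side_def k j by (simp_all add: algebra_simps)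
  then show "side r j \<bullet> side r k = side r 0 \<bullet> side r m"
    by (simp only: cis_inner)
qed

lemma edge_pair_sum:
  "(\<Sum>k<12. \<Sum>j<12. (side r j \<bullet> side r k) * integral {0..1} (\<lambda>t. integral {0..1} (\<lambda>s. cmod (edge r k t - edge r j s) ^ 3)))
    = 12 * (\<Sum>m<12. (side r 0 \<bullet> side r m) * edge_integral r m)"
proof -
  let ?f = "\<lambda>m. (side r 0 \<bullet> side r m) * edge_integral r m"
  have "(\<Sum>k<12. \<Sum>j<12. (side r j \<bullet> side r k) * integral {0..1} (\<lambda>t. integral {0..1} (\<lambda>s. cmod (edge r k t - edge r j s) ^ 3)))
    = (\<Sum>j<12. \<Sum>k<12. (side r j \<bullet> side r k) * integral {0..1} (\<lambda>t. integral {0..1} (\<lambda>s. cmod (edge r k t - edge r j s) ^ 3)))"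
    by (rule sum.swap)
  also have "\<dots> = (\<Sum>j<12::nat. \<Sum>m<12. ?f m)"
  proof (rule sum.cong[OF refl])
    fix j :: nat assume "j \<in> {..<12}"
    then have j: "j < 12" by simp
    \<comment> \<open>For fixed \<open>j\<close> the relative position of side \<open>k\<close> runs
      through all residues modulo 12; \<open>12 - j\<close> stands for \<open>- j\<close>, since
      subtraction of natural numbers would truncate.\<close>
    have "(\<Sum>m<12. ?f m) = (\<Sum>k<12. ?f ((k + (12 - j)) mod 12))"
    proof (rule sum.reindex_bij_witness[where i = "\<lambda>k. (k + (12 - j)) mod 12" and j = "\<lambda>m. (m + j) mod 12"])
      fix a :: nat assume a: "a \<in> {..<12}"
      have "((a + j) mod 12 + (12 - j)) mod 12 = (a + j + (12 - j)) mod 12" by (rule mod_add_left_eq)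
      also have "\<dots> = (a + 12) mod 12" using j by simp
      also have "\<dots> = a" using a by simp
      finally show "((a + j) mod 12 + (12 - j)) mod 12 = a" .
      then show "?f (((a + j) mod 12 + (12 - j)) mod 12) = ?f a" by simp
      show "(a + j) mod 12 \<in> {..<12}" "(a + (12 - j)) mod 12 \<in> {..<12}" by simp_all
      have "((a + (12 - j)) mod 12 + j) mod 12 = (a + (12 - j) + j) mod 12" by (rule mod_add_left_eq)
      also have "\<dots> = (a + 12) mod 12" using j by simp
      also have "\<dots> = a" using a by simp
      finally show "((a + (12 - j)) mod 12 + j) mod 12 = a" .
    qed
    also have "\<dots> = (\<Sum>k<12. (side r j \<bullet> side r k) * integral {0..1} (\<lambda>t. integral {0..1} (\<lambda>s. cmod (edge r k t - edge r j s) ^ 3)))"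
    proof (rule sum.cong[OF refl])
      fix k :: nat
      have "(j + (k + (12 - j)) mod 12) mod 12 = (j + (k + (12 - j))) mod 12" by (rule mod_add_right_eq)
      also have "\<dots> = (k + 12) mod 12" using j by (simp add: add.commute)
      finally have e: "(j + (k + (12 - j)) mod 12) mod 12 = k mod 12" by simp
      show "?f ((k + (12 - j)) mod 12) = (side r j \<bullet> side r k) * integral {0..1} (\<lambda>t. integral {0..1} (\<lambda>s. cmod (edge r k t - edge r j s) ^ 3))"
        unfolding edge_pair_rotate[OF j e] ..
    qed
    finally show "(\<Sum>k<12. (side r j \<bullet> side r k) * integral {0..1} (\<lambda>t. integral {0..1} (\<lambda>s. cmod (edge r k t - edge r j s) ^ 3))) = (\<Sum>m<12. ?f m)" ..
  qed
  also have "\<dots> = 12 * (\<Sum>m<12. ?f m)" by simp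
  finally show ?thesis .
qed

section \<open>Distances between points of two sides as third sides of triangles\<close>

text \<open>\<open>k\<close> will be the actual side length, in units of which \<open>u\<close> and
  \<open>v\<close> are measured. Comparing squares turns the law of cosines into a polynomial
  identity in coordinates.\<close>

lemma cmod_eq_third_side:
  assumes "k \<ge> 0" "Re w * Re w + Im w * Im w = (k * k) * (u * u + v * v - 2 * u * v * c)"
  shows "cmod w = k * third_side c u v"
proof -
  have "cmod w = sqrt ((k * k) * (u * u + v * v - 2 * u * v * c))"
    unfolding assms(2)[symmetric] by (simp add: cmod_def power2_eq_square)
  then show ?thesis
    unfolding real_sqrt_mult third_side_def power2_eq_square using assms(1) by simp
qed

text \<open>When both sides are passed counterclockwise, the distance from the intersection of their
  lines grows along one and shrinks along the other. It grows along side \<open>m\<close> for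
  \<open>m < 6\<close> and along side 0 for \<open>m > 6\<close>; this is the origin of
  \<open>1 - s\<close> and \<open>1 - t\<close>.\<close>

lemma edge_integral_third_side:
  fixes c a :: real
  defines "I \<equiv> integral {0..1} (\<lambda>s. integral {0..1} (\<lambda>t. third_side c (s + a) (t + a) ^ 3))"
  shows "(\<And>s t. cmod (edge r m t - edge r 0 s) = k * third_side c (t + a) ((1 - s) + a)) \<Longrightarrow> edge_integral r m = k ^ 3 * I"
    "(\<And>s t. cmod (edge r m t - edge r 0 s) = k * third_side c ((1 - t) + a) (s + a)) \<Longrightarrow> edge_integral r m = k ^ 3 * I"
proof -
  assume e: "\<And>s t. cmod (edge r m t - edge r 0 s) = k * third_side c (t + a) ((1 - s) + a)"
  show "edge_integral r m = k ^ 3 * I"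
    unfolding edge_integral_def e power_mult_distrib I_def
    using integral_reverse01[of "\<lambda>s. third_side c (u + a) (s + a) ^ 3" for u] by simp
next
  assume e: "\<And>s t. cmod (edge r m t - edge r 0 s) = k * third_side c ((1 - t) + a) (s + a)"
  show "edge_integral r m = k ^ 3 * I"
    unfolding edge_integral_def e power_mult_distrib I_def
    using integral_reverse01[of "\<lambda>t. integral {0..1} (\<lambda>s. third_side c (t + a) (s + a) ^ 3)"] by simp
qed

context
  fixes x y r :: real
  assumes x: "x = sqrt 2" and y: "y = sqrt 3" and r: "r > 0"
begin

text \<open>The side is \<open>2 * r * sin (pi / 12)\<close>, that is, \<open>r\<close> times the
  square root of \<open>2 - y\<close>.\<close>

lemma edge_length: "r * ((x * y - x) / 2) \<ge> 0" "r * ((x * y - x) / 2) * (r * ((x * y - x) / 2)) = r * r * (2 - y)"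
  using r tau_pos[OF x y] by (simp_all add: field_simps sqrt23[OF x y])

lemma Suc_numerals: "Suc 0 = 1" "Suc 1 = 2" "Suc 2 = 3" "Suc 3 = 4" "Suc 4 = 5" "Suc 5 = 6" "Suc 6 = 7" "Suc 7 = 8" "Suc 8 = 9"
  "Suc 9 = 10" "Suc 10 = 11" "Suc 11 = 12"
  by simp_all

text \<open>What remains for \<open>simp\<close> is the law of cosines in vertex coordinates, a
  polynomial identity in \<open>s\<close> and \<open>t\<close>. The values for \<open>m\<close> and
  \<open>12 - m\<close> coincide, because a reflection of the dodecagon exchanges the two pairs of
  sides.\<close>

lemma edge_integral_1: "edge_integral r 1 = (r * ((x * y - x) / 2)) ^ 3 * ((167 / 320 * x - 11 / 160 * y + 97 / 320 * (x * y)) + (- 3 / 640) * ln (2 + y) + (3 / 320) * ln (2 + ((x * y + x) / 2)))"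
  unfolding double_integral_1[OF x y, symmetric]
  by (rule edge_integral_third_side(1), rule cmod_eq_third_side[OF edge_length(1)],
    unfold edge_length(2) edge_def Suc_numerals vertex_values y[symmetric], simp add: field_simps sqrt23[OF x y])

lemma edge_integral_11: "edge_integral r 11 = (r * ((x * y - x) / 2)) ^ 3 * ((167 / 320 * x - 11 / 160 * y + 97 / 320 * (x * y)) + (- 3 / 640) * ln (2 + y) + (3 / 320) * ln (2 + ((x * y + x) / 2)))"
  unfolding double_integral_1[OF x y, symmetric]
  by (rule edge_integral_third_side(2), rule cmod_eq_third_side[OF edge_length(1)],
    unfold edge_length(2) edge_def Suc_numerals vertex_values y[symmetric], simp add: field_simps sqrt23[OF x y])

lemma edge_integral_2: "edge_integral r 2 = (r * ((x * y - x) / 2)) ^ 3 * ((847 / 160 - 81 / 64 * x + 121 / 40 * y - 233 / 320 * (x * y)) + (- 33 / 80 - 19 / 80 * y) * ln (1 + x) + (33 / 80 + 153 / 640 * y) * ln (2 + y) + (- 1 / 320 * y) * ln (2 + ((x * y + x) / 2)))"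
  unfolding double_integral_2[OF x y, symmetric]
  by (rule edge_integral_third_side(1), rule cmod_eq_third_side[OF edge_length(1)],
    unfold edge_length(2) edge_def Suc_numerals vertex_values y[symmetric], simp add: field_simps sqrt23[OF x y])

lemma edge_integral_10: "edge_integral r 10 = (r * ((x * y - x) / 2)) ^ 3 * ((847 / 160 - 81 / 64 * x + 121 / 40 * y - 233 / 320 * (x * y)) + (- 33 / 80 - 19 / 80 * y) * ln (1 + x) + (33 / 80 + 153 / 640 * y) * ln (2 + y) + (- 1 / 320 * y) * ln (2 + ((x * y + x) / 2)))"
  unfolding double_integral_2[OF x y, symmetric]
  by (rule edge_integral_third_side(2), rule cmod_eq_third_side[OF edge_length(1)],
    unfold edge_length(2) edge_def Suc_numerals vertex_values y[symmetric], simp add: field_simps sqrt23[OF x y])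

lemma edge_integral_3: "edge_integral r 3 = (r * ((x * y - x) / 2)) ^ 3 * ((- 231 / 20 + 553 / 40 * x - 133 / 20 * y + 637 / 80 * (x * y)) + (- 891 / 320 - 513 / 320 * y) * ln 3 + (237 / 40 + 273 / 80 * y) * ln (1 + x) + (- 57 / 160 - 33 / 160 * y) * ln (2 + y))"
  unfolding double_integral_3[OF x y, symmetric]
  by (rule edge_integral_third_side(1), rule cmod_eq_third_side[OF edge_length(1)],
    unfold edge_length(2) edge_def Suc_numerals vertex_values y[symmetric], simp add: field_simps sqrt23[OF x y])

lemma edge_integral_9: "edge_integral r 9 = (r * ((x * y - x) / 2)) ^ 3 * ((- 231 / 20 + 553 / 40 * x - 133 / 20 * y + 637 / 80 * (x * y)) + (- 891 / 320 - 513 / 320 * y) * ln 3 + (237 / 40 + 273 / 80 * y) * ln (1 + x) + (- 57 / 160 - 33 / 160 * y) * ln (2 + y))"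
  unfolding double_integral_3[OF x y, symmetric]
  by (rule edge_integral_third_side(2), rule cmod_eq_third_side[OF edge_length(1)],
    unfold edge_length(2) edge_def Suc_numerals vertex_values y[symmetric], simp add: field_simps sqrt23[OF x y])

lemma edge_integral_4: "edge_integral r 4 = (r * ((x * y - x) / 2)) ^ 3 * ((3723 / 80 - 8073 / 320 * x + 4301 / 160 * y - 4671 / 320 * (x * y)) + (5913 / 320 + 6831 / 640 * y) * ln 3 + (- 513 / 80 - 297 / 80 * y) * ln (1 + x) + (4887 / 320 + 5643 / 640 * y) * ln (2 + y) + (- 4887 / 160 - 5643 / 320 * y) * ln (2 + ((x * y - x) / 2)))"
  unfolding double_integral_4[OF x y, symmetric]
  by (rule edge_integral_third_side(1), rule cmod_eq_third_side[OF edge_length(1)],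
    unfold edge_length(2) edge_def Suc_numerals vertex_values y[symmetric], simp add: field_simps sqrt23[OF x y])

lemma edge_integral_8: "edge_integral r 8 = (r * ((x * y - x) / 2)) ^ 3 * ((3723 / 80 - 8073 / 320 * x + 4301 / 160 * y - 4671 / 320 * (x * y)) + (5913 / 320 + 6831 / 640 * y) * ln 3 + (- 513 / 80 - 297 / 80 * y) * ln (1 + x) + (4887 / 320 + 5643 / 640 * y) * ln (2 + y) + (- 4887 / 160 - 5643 / 320 * y) * ln (2 + ((x * y - x) / 2)))"
  unfolding double_integral_4[OF x y, symmetric]
  by (rule edge_integral_third_side(2), rule cmod_eq_third_side[OF edge_length(1)],
    unfold edge_length(2) edge_def Suc_numerals vertex_values y[symmetric], simp add: field_simps sqrt23[OF x y])

lemma edge_integral_5: "edge_integral r 5 = (r * ((x * y - x) / 2)) ^ 3 * ((- 10659 / 160 + 17377 / 320 * x - 3077 / 80 * y + 10037 / 320 * (x * y)) + (- 16929 / 640 - 4887 / 320 * y) * ln 3 + (- 51681 / 640 - 14919 / 320 * y) * ln (2 + y) + (51681 / 320 + 14919 / 160 * y) * ln (2 + ((x * y - x) / 2)))"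
  unfolding double_integral_5[OF x y, symmetric]
  by (rule edge_integral_third_side(1), rule cmod_eq_third_side[OF edge_length(1)],
    unfold edge_length(2) edge_def Suc_numerals vertex_values y[symmetric], simp add: field_simps sqrt23[OF x y])

lemma edge_integral_7: "edge_integral r 7 = (r * ((x * y - x) / 2)) ^ 3 * ((- 10659 / 160 + 17377 / 320 * x - 3077 / 80 * y + 10037 / 320 * (x * y)) + (- 16929 / 640 - 4887 / 320 * y) * ln 3 + (- 51681 / 640 - 14919 / 320 * y) * ln (2 + y) + (51681 / 320 + 14919 / 160 * y) * ln (2 + ((x * y - x) / 2)))"
  unfolding double_integral_5[OF x y, symmetric]
  by (rule edge_integral_third_side(2), rule cmod_eq_third_side[OF edge_length(1)],
    unfold edge_length(2) edge_def Suc_numerals vertex_values y[symmetric], simp add: field_simps sqrt23[OF x y])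

lemma edge_integral_6: "edge_integral r 6 = (r * ((x * y - x) / 2)) ^ 3 * ((724 / 5 - 1947 / 20 * x + 418 / 5 * y - 1123 / 20 * (x * y)) + (- 291 / 8 - 21 * y) * ln (2 + y) + (291 / 4 + 42 * y) * ln (2 + ((x * y - x) / 2)))"
proof -
  \<comment> \<open>Opposite sides are passed in opposite directions, hence
    \<open>1 - s\<close>.\<close>
  have e: "cmod (edge r 6 t - edge r 0 s) = r * ((x * y - x) / 2) * third_side 0 (2 + y) (t - (1 - s))" for s t
    by (rule cmod_eq_third_side[OF edge_length(1)],
      unfold edge_length(2) edge_def Suc_numerals vertex_values y[symmetric], simp add: field_simps sqrt23[OF x y])
  show ?thesis
    unfolding double_integral_6[OF x y, symmetric] edge_integral_def e power_mult_distrib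
    using integral_reverse01[of "\<lambda>s. third_side 0 (2 + y) (u - s) ^ 3" for u] by simp
qed

lemma edge_integral_0: "edge_integral r 0 = (r * ((x * y - x) / 2)) ^ 3 * (1 / 10)"
proof -
  have "cmod (edge r 0 t - edge r 0 s) = r * ((x * y - x) / 2) * \<bar>t - s\<bar>" for s t
  proof -
    \<comment> \<open>Height 0 turns the third side into an absolute value.\<close>
    have "cmod (edge r 0 t - edge r 0 s) = r * ((x * y - x) / 2) * third_side 0 0 (t - s)"
      by (rule cmod_eq_third_side[OF edge_length(1)],
        unfold edge_length(2) edge_def Suc_numerals vertex_values y[symmetric], simp add: field_simps sqrt23[OF x y])
    then show ?thesis by (simp add: third_side_def)
  qed
  note e = this
  show ?thesis
    unfolding edge_integral_def e power_mult_distrib using double_integral_collinear by simp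
qed

text \<open>The squared side length times the cosine of the turning angle \<open>m * pi / 6\<close>;
  the perpendicular sides 3 and 9 drop out of the sum.\<close>

lemma side_inner:
  "side r 0 \<bullet> side r 0 = r * r * (2 - y) * (1)"
  "side r 0 \<bullet> side r 1 = r * r * (2 - y) * (y / 2)"
  "side r 0 \<bullet> side r 2 = r * r * (2 - y) * (1 / 2)"
  "side r 0 \<bullet> side r 3 = r * r * (2 - y) * (0)"
  "side r 0 \<bullet> side r 4 = r * r * (2 - y) * (- (1 / 2))"
  "side r 0 \<bullet> side r 5 = r * r * (2 - y) * (- (y / 2))"
  "side r 0 \<bullet> side r 6 = r * r * (2 - y) * (- 1)"
  "side r 0 \<bullet> side r 7 = r * r * (2 - y) * (- (y / 2))"
  "side r 0 \<bullet> side r 8 = r * r * (2 - y) * (- (1 / 2))"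
  "side r 0 \<bullet> side r 9 = r * r * (2 - y) * (0)"
  "side r 0 \<bullet> side r 10 = r * r * (2 - y) * (1 / 2)"
  "side r 0 \<bullet> side r 11 = r * r * (2 - y) * (y / 2)"
  by (unfold side_def Suc_numerals vertex_values y[symmetric] inner_complex_def, simp_all add: field_simps sqrt23[OF x y])

section \<open>Summation and the closed form\<close>

text \<open>Two powers of the side length come from the inner product and three from the cubed
  distance, against \<open>r ^ 4\<close> from the squared area: one factor \<open>r\<close> is
  left.\<close>

lemma mean_distance_dodecagon:
  "mean_distance (regular_polygon 12 r) / r = (- 13 / 60 + 7 / 30 * x - 23 / 180 * y + 11 / 60 * (x * y)) + (- 3 / 32 * x - 11 / 160 * (x * y)) * ln 3 + (- 1 / 20 * x + 1 / 540 * (x * y)) * ln (1 + x) + (- 37 / 60 * x - 133 / 360 * (x * y)) * ln (2 + y) + (- 11 / 720 * x + 19 / 2160 * (x * y)) * ln (2 + ((x * y + x) / 2)) + (899 / 720 * x + 523 / 720 * (x * y)) * ln (2 + ((x * y - x) / 2))"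
proof -
  have A: "measure lborel (dodecagon r) = 3 * r\<^sup>2" by (rule measure_dodecagon[OF r])
  have cube: "(r * ((x * y - x) / 2)) ^ 3 = r * r * r * (- 5 / 2 * x + 3 / 2 * (x * y))"
    by (simp add: power3_eq_cube field_simps sqrt23[OF x y])
  \<comment> \<open>Opaque names for the logarithms make the remaining equation linear in them, with
    coefficients in the field.\<close>
  define l2 l3 q v P M where logs: "l2 = ln (2::real)" "l3 = ln (3::real)" "q = ln (1 + x)" "v = ln (2 + y)" "P = ln (2 + ((x * y + x) / 2))" "M = ln (2 + ((x * y - x) / 2))"
  have "mean_distance (regular_polygon 12 r) = - (1 / 9) * (12 * (\<Sum>m<12. (side r 0 \<bullet> side r m) * edge_integral r m)) / (3 * r\<^sup>2)\<^sup>2"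
    unfolding regular_polygon_12[OF r] using r
    by (subst mean_distance_compact[OF compact_dodecagon])
      (simp_all add: A dist_norm double_integral_dodecagon_norm[OF r] edge_pair_sum)
  also have "\<dots> = r * ((- 13 / 60 + 7 / 30 * x - 23 / 180 * y + 11 / 60 * (x * y)) + (- 3 / 32 * x - 11 / 160 * (x * y)) * l3 + (- 1 / 20 * x + 1 / 540 * (x * y)) * q + (- 37 / 60 * x - 133 / 360 * (x * y)) * v + (- 11 / 720 * x + 19 / 2160 * (x * y)) * P + (899 / 720 * x + 523 / 720 * (x * y)) * M)"
    unfolding sum_lessThan_12 side_inner edge_integral_0 edge_integral_1 edge_integral_2 edge_integral_3 edge_integral_4 edge_integral_5
      edge_integral_6 edge_integral_7 edge_integral_8 edge_integral_9 edge_integral_10 edge_integral_11 cube logs[symmetric]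
    using r by (simp add: field_simps power2_eq_square sqrt23[OF x y])
  finally show ?thesis using r unfolding logs by simp
qed

end

theorem mainTheorem7:
  fixes r :: real
  assumes "r > 0"
  shows "mean_distance (regular_polygon 12 r) / r =
    1 / (1080 * sqrt 2) *
      (504 - 660 * sqrt 2 + 396 * sqrt 3 - 4 * sqrt 6
       + 2 * (3 + sqrt 3) * sqrt (2 + sqrt 3)
       + 6 * (1 + 47 * sqrt 3) * sqrt (2 - sqrt 3)
       - 27 / 2 * (15 + 11 * sqrt 3) * ln 3
       - 4 * (27 - sqrt 3) * ln (1 + sqrt 2)
       - 4 * sqrt 3 * ln (2 + sqrt 3)
       + 2 * (666 + 397 * sqrt 3) * ln (2 - sqrt 3)
       - (33 - 19 * sqrt 3) * ln (2 + sqrt (2 + sqrt 3))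
       + 3 * (899 + 523 * sqrt 3) * ln (2 + sqrt (2 - sqrt 3)))"
proof -
  define x y where x: "x = sqrt (2::real)" and y: "y = sqrt (3::real)"
  note b = sqrt23_bounds[OF x y] tau_pos[OF x y] and s = sqrt23[OF x y]
  have six: "sqrt 6 = x * y"
    unfolding x y real_sqrt_mult[symmetric] by simp
  \<comment> \<open>The nested radicals of the statement lie in the field: squaring
    \<open>(x * y + x) / 2\<close> and \<open>(x * y - x) / 2\<close> gives \<open>2 + y\<close> and
    \<open>2 - y\<close>.\<close>
  have sig: "sqrt (2 + y) = (x * y + x) / 2"
    using b by (intro real_sqrt_unique) (simp_all add: power2_eq_square field_simps s)
  have tau: "sqrt (2 - y) = (x * y - x) / 2"
    using b by (intro real_sqrt_unique) (simp_all add: power2_eq_square field_simps s)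
  have inv: "1 / (1080 * x) = x / 2160"
    using b by (simp add: field_simps s)
  define l3 q v P M where logs: "l3 = ln (3::real)" "q = ln (1 + x)" "v = ln (2 + y)" "P = ln (2 + ((x * y + x) / 2))" "M = ln (2 + ((x * y - x) / 2))"
  \<comment> \<open>Since \<open>ln (2 - y) = - ln (2 + y)\<close>, two summands of the claim merge;
    what is left is a comparison of coefficients in the basis \<open>1, x, y, x * y\<close>.\<close>
  show ?thesis
    unfolding mean_distance_dodecagon[OF x y assms] x[symmetric] y[symmetric] six sig tau inv ln_sqrt23(4)[OF x y] logs[symmetric]
    by (simp add: field_simps s)
qed

end
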